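(* Let $q=p^a$ be a prime power, let $\omega$ be a primitive element of $\mathbb{F}_q$ (a generator of $\mathbb{F}_q^*$), let $h\ge 1$, let $\lambda_1<\lambda_2<\cdots<\lambda_h$ and $l_1,\ldots,l_h$ be positive integers, and let $\mathbb{F}_q[t]_\lambda$ be the algebra defined in the context. Then the unit group $\mathbb{F}_q[t]_\lambda^*$ is generated by the following elements: (1) $\mathtt{a}_i(y)$ for $1\le i\le h$, where $y$ runs over a generating set of ${\rm GL}_{l_i}(q)$ (regarded as the subgroup of constant matrices in ${\rm GL}_{l_i}(\mathbb{F}_q[t]_{\lambda_i})$); (2) $\mathtt{b}_i(\mu)$ for $1\le i\le h$, where $\mu$ runs over the set $\{1+\omega^j t^l : 0\le j\le [\mathbb{F}_q:\mathbb{F}_p],\ 1\le l\le \lambda_i-1\}$; (3) $\mathtt{c}_i^+$ and $\mathtt{c}_i^-$ for $1\le i\le h-1$.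
   Context: For a positive integer $s$ let $\mathbb{F}_q[t]_s=\mathbb{F}_q[t]/(t^s)$ (truncated polynomial algebra). The algebra $\mathbb{F}_q[t]_\lambda$ consists of $h\times h$ block matrices $A=(A_{ij})$, where $A_{ij}$ is an $l_i\times l_j$ matrix whose entries lie in $\mathbb{F}_q[t]_{\lambda_j}$, and, if $i<j$, are (residues of) polynomials divisible by $t^{\lambda_j-\lambda_i}$ (i.e. lie in $t^{\lambda_j-\lambda_i}\mathbb{F}_q[t]_{\lambda_j}$). Thus all entries in block column $j$ are residues modulo $t^{\lambda_j}$. Multiplication: lift all entries to polynomials, multiply as matrices over $\mathbb{F}_q[t]$, and reduce the entries of block column $j$ modulo $t^{\lambda_j}$; this is a well-defined associative $\mathbb{F}_q$-algebra (isomorphic to the centralizer in $M_n(\mathbb{F}_q)$, $n=\sum_i\lambda_il_i$, of the unipotent matrix that is a block diagonal sum of $l_i$ unipotent Jordan blocks of size $\lambda_i$ for each $i$), and $\mathbb{F}_q[t]_\lambda^*$ denotes its group of units. Elements: for $1\le i\le h$ and $y\in{\rm GL}_{l_i}(\mathbb{F}_q[t]_{\lambda_i})$, $\mathtt{a}_i(y)$ is the identity of $\mathbb{F}_q[t]_\lambda$ with the block $A_{ii}$ replaced by $y$; for a unit $\mu\in\mathbb{F}_q[t]_{\lambda_i}$, $\mathtt{b}_i(\mu)$ is the identity with $A_{ii}$ replaced by ${\rm diag}(\mu,1,\ldots,1)$; for $1\le i\le h-1$, $\mathtt{c}_i^+$ is the identity with the block $A_{i,i+1}$ replaced by the $l_i\times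 l_{i+1}$ matrix having $t^{\lambda_{i+1}-\lambda_i}$ in its bottom-left corner and $0$ elsewhere, and $\mathtt{c}_i^-$ is the identity with the block $A_{i+1,i}$ replaced by the $l_{i+1}\times l_i$ matrix having $1$ in its top-right corner and $0$ elsewhere. *)

theory Defs
  imports "HOL-Algebra.Generated_Groups" "HOL-Computational_Algebra.Polynomial"
begin

definition mat_carrier :: "nat \<Rightarrow> (nat \<Rightarrow> nat \<Rightarrow> 'a::comm_ring_1) set" where
  "mat_carrier n = {A. \<forall>i j. (n \<le> i \<or> n \<le> j) \<longrightarrow> A i j = 0}"

definition mat_mult :: "nat \<Rightarrow> (nat \<Rightarrow> nat \<Rightarrow> 'a::comm_ring_1) \<Rightarrow> (nat \<Rightarrow> nat \<Rightarrow> 'a) \<Rightarrow> nat \<Rightarrow> nat \<Rightarrow> 'a" where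
  "mat_mult n A B = (\<lambda>i j. if i < n \<and> j < n then (\<Sum>k<n. A i k * B k j) else 0)"

definition mat_one :: "nat \<Rightarrow> nat \<Rightarrow> nat \<Rightarrow> 'a::comm_ring_1" where
  "mat_one n = (\<lambda>i j. if i < n \<and> i = j then 1 else 0)"

definition matrix_monoid :: "nat \<Rightarrow> (nat \<Rightarrow> nat \<Rightarrow> 'a::comm_ring_1) monoid" where
  "matrix_monoid n = \<lparr>carrier = mat_carrier n, monoid.mult = mat_mult n, one = mat_one n\<rparr>"

definition GL_grp :: "nat \<Rightarrow> (nat \<Rightarrow> nat \<Rightarrow> 'a::comm_ring_1) monoid" where
  "GL_grp n = units_of (matrix_monoid n)"

text \<open>Rows/columns are indexed by pairs (i,r), i < h the block index (0-based),
  r < l i the position inside block i. Entries are polynomials; an entry in block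
  column j is the canonical representative (degree < lam j) of a residue mod t^(lam j).\<close>

definition blk_idx :: "nat \<Rightarrow> (nat \<Rightarrow> nat) \<Rightarrow> (nat \<times> nat) set" where
  "blk_idx h l = {(i, r). i < h \<and> r < l i}"

definition tpow :: "nat \<Rightarrow> 'a::field poly" where
  "tpow k = monom 1 k"

definition lam_carrier :: "nat \<Rightarrow> (nat \<Rightarrow> nat) \<Rightarrow> (nat \<Rightarrow> nat)
    \<Rightarrow> (nat \<times> nat \<Rightarrow> nat \<times> nat \<Rightarrow> 'a::field poly) set" where
  "lam_carrier h lam l = {A.
     (\<forall>x y. (x \<notin> blk_idx h l \<or> y \<notin> blk_idx h l) \<longrightarrow> A x y = 0) \<and>
     (\<forall>x\<in>blk_idx h l. \<forall>y\<in>blk_idx h l.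
        A x y mod tpow (lam (fst y)) = A x y \<and>
        (fst x < fst y \<longrightarrow> tpow (lam (fst y) - lam (fst x)) dvd A x y))}"

definition lam_mult :: "nat \<Rightarrow> (nat \<Rightarrow> nat) \<Rightarrow> (nat \<Rightarrow> nat)
    \<Rightarrow> (nat \<times> nat \<Rightarrow> nat \<times> nat \<Rightarrow> 'a::field poly)
    \<Rightarrow> (nat \<times> nat \<Rightarrow> nat \<times> nat \<Rightarrow> 'a poly)
    \<Rightarrow> (nat \<times> nat \<Rightarrow> nat \<times> nat \<Rightarrow> 'a poly)" where
  "lam_mult h lam l A B = (\<lambda>x y. if x \<in> blk_idx h l \<and> y \<in> blk_idx h l
      then (\<Sum>z\<in>blk_idx h l. A x z * B z y) mod tpow (lam (fst y)) else 0)"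

definition lam_one :: "nat \<Rightarrow> (nat \<Rightarrow> nat) \<Rightarrow> (nat \<times> nat \<Rightarrow> nat \<times> nat \<Rightarrow> 'a::field poly)" where
  "lam_one h l = (\<lambda>x y. if x \<in> blk_idx h l \<and> x = y then 1 else 0)"

definition lam_alg :: "nat \<Rightarrow> (nat \<Rightarrow> nat) \<Rightarrow> (nat \<Rightarrow> nat)
    \<Rightarrow> (nat \<times> nat \<Rightarrow> nat \<times> nat \<Rightarrow> 'a::field poly) monoid" where
  "lam_alg h lam l = \<lparr>carrier = lam_carrier h lam l, monoid.mult = lam_mult h lam l, one = lam_one h l\<rparr>"

definition lam_units :: "nat \<Rightarrow> (nat \<Rightarrow> nat) \<Rightarrow> (nat \<Rightarrow> nat)
    \<Rightarrow> (nat \<times> nat \<Rightarrow> nat \<times> nat \<Rightarrow> 'a::field poly) monoid" where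
  "lam_units h lam l = units_of (lam_alg h lam l)"

definition elem_a :: "nat \<Rightarrow> (nat \<Rightarrow> nat) \<Rightarrow> nat \<Rightarrow> (nat \<Rightarrow> nat \<Rightarrow> 'a::field poly)
    \<Rightarrow> (nat \<times> nat \<Rightarrow> nat \<times> nat \<Rightarrow> 'a poly)" where
  "elem_a h l i y = (\<lambda>x z. if x \<in> blk_idx h l \<and> z \<in> blk_idx h l then
      (if fst x = i \<and> fst z = i then y (snd x) (snd z) else if x = z then 1 else 0)
    else 0)"

definition const_mat :: "(nat \<Rightarrow> nat \<Rightarrow> 'a::zero) \<Rightarrow> nat \<Rightarrow> nat \<Rightarrow> 'a poly" where
  "const_mat y = (\<lambda>r s. [:y r s:])"

definition elem_b :: "nat \<Rightarrow> (nat \<Rightarrow> nat) \<Rightarrow> nat \<Rightarrow> 'a::field poly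
    \<Rightarrow> (nat \<times> nat \<Rightarrow> nat \<times> nat \<Rightarrow> 'a poly)" where
  "elem_b h l i mu = (lam_one h l)((i, 0) := ((lam_one h l) (i, 0))((i, 0) := mu))"

definition elem_cplus :: "nat \<Rightarrow> (nat \<Rightarrow> nat) \<Rightarrow> (nat \<Rightarrow> nat) \<Rightarrow> nat
    \<Rightarrow> (nat \<times> nat \<Rightarrow> nat \<times> nat \<Rightarrow> 'a::field poly)" where
  "elem_cplus h lam l i = (lam_one h l)((i, l i - 1) :=
     ((lam_one h l) (i, l i - 1))((i + 1, 0) := tpow (lam (i + 1) - lam i)))"

definition elem_cminus :: "nat \<Rightarrow> (nat \<Rightarrow> nat) \<Rightarrow> nat
    \<Rightarrow> (nat \<times> nat \<Rightarrow> nat \<times> nat \<Rightarrow> 'a::field poly)" where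
  "elem_cminus h l i = (lam_one h l)((i + 1, 0) :=
     ((lam_one h l) (i + 1, 0))((i, l i - 1) := 1))"

end

(*
  A matrix of the algebra is lifted to a polynomial matrix whose (x, y) entry is divisible by
  t^(lambda_y - lambda_x) (truncated difference); reduction of the columns is multiplicative on
  such lifts, so all matrix identities can be checked over the polynomial ring.

  Let G be the generated subgroup. The powers omega^j, 0 <= j <= a, span F_q additively, so working
  upwards in powers of t the elements b_i(1 + omega^j t^k) yield all dilations by units congruent
  to 1 mod t. Conjugation by constant swaps moves everything to arbitrary positions inside a block.
  For x /= y the polynomials f with the transvection E_xy(f) in G form an ideal, because it is stable
  under addition and under conjugation by dilations; commutators of the constant transvections and
  of c_i^+, c_i^- show that it contains t^(lambda_y - lambda_x), hence every admissible f.
  The diagonal blocks of a unit are invertible mod t; after dividing by their constant parts all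
  pivots are units, and Gaussian elimination finishes the proof.
*)

theory Submission
  imports Defs "HOL-Number_Theory.Cong" "HOL-Combinatorics.Transposition"
begin

section \<open>Truncated polynomials\<close>

lemma tpow_dvd_iff: "tpow n dvd p \<longleftrightarrow> (\<forall>k<n. coeff p k = 0)"
  unfolding tpow_def by (rule monom_1_dvd_iff')

lemma tpow_add: "tpow (m + n) = tpow m * (tpow n :: 'a::field poly)"
  by (simp add: tpow_def mult_monom)

lemma tpow_dvd_tpow: "m \<le> n \<Longrightarrow> tpow m dvd (tpow n :: 'a::field poly)"
  by (metis tpow_add dvd_triv_left le_add_diff_inverse)

lemma tpow_0 [simp]: "tpow 0 = (1 :: 'a::field poly)"
  by (simp add: tpow_def monom_0)

lemma coeff_0_tpow_dvd: "0 < n \<Longrightarrow> tpow n dvd p \<Longrightarrow> coeff p 0 = 0"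
  by (simp add: tpow_dvd_iff)

lemma mod_tpow_monom: "k < n \<Longrightarrow> monom c k mod tpow n = (monom c k :: 'a::field poly)"
  by (rule mod_poly_less) (auto simp: tpow_def degree_monom_eq intro: le_less_trans[OF degree_monom_le])

lemma mod_tpow_const: "0 < n \<Longrightarrow> [:c:] mod tpow n = ([:c:] :: 'a::field poly)"
  using mod_tpow_monom[of 0 n c] by (simp add: monom_0)

lemma mod_tpow_one: "0 < n \<Longrightarrow> 1 mod tpow n = (1 :: 'a::field poly)"
  using mod_tpow_const[of n 1] by (simp add: one_pCons)

text \<open>Geometric series: \<open>d = c (1 - e)\<close> with \<open>e\<close> divisible by
  \<open>t\<close>, so \<open>e ^ n\<close> vanishes modulo \<open>t ^ n\<close>.\<close>

lemma inverse_mod_tpow: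
  assumes "coeff (d :: 'a::field poly) 0 \<noteq> 0"
  obtains w where "tpow n dvd d * w - 1"
proof -
  define c where "c = coeff d 0"
  define e where "e = 1 - smult (1 / c) d"
  have "tpow 1 dvd e"
    using assms by (simp add: tpow_dvd_iff e_def c_def)
  then have "tpow 1 ^ n dvd e ^ n"
    by (rule dvd_power_same)
  then have "tpow n dvd e ^ n"
    by (simp add: tpow_def monom_power)
  moreover have "1 - e ^ n = d * smult (1 / c) (\<Sum>k<n. e ^ k)"
    by (simp add: one_diff_power_eq e_def)
  then have "d * smult (1 / c) (\<Sum>k<n. e ^ k) - 1 = - (e ^ n)"
    by (metis add_diff_cancel_left' diff_add_cancel minus_diff_eq)
  ultimately show ?thesis
    using that by (metis dvd_minus_iff)
qed

section \<open>Additive span of powers of a primitive element\<close>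

text \<open>The translation by 1 permutes the ring, so it leaves the sum of all elements
  unchanged.\<close>

lemma of_nat_card_eq_0: "of_nat (card (UNIV :: 'a set)) = (0 :: 'a::{finite, ring_1})"
proof -
  have "(\<Sum>x\<in>UNIV. x + 1) = (\<Sum>x\<in>UNIV. x :: 'a)"
    by (rule sum.reindex_bij_witness[of _ "\<lambda>x. x - 1" "\<lambda>x. x + 1"]) auto
  then show ?thesis
    by (simp add: sum.distrib)
qed

text \<open>In characteristic \<open>p\<close> this is the span of the first \<open>k\<close> powers
  of \<open>w\<close> over the prime field; natural coefficients are enough because -1 is
  \<open>p - 1\<close>.\<close>

fun pspan :: "'a::comm_semiring_1 \<Rightarrow> nat \<Rightarrow> 'a set" where
  "pspan w 0 = {0}"
| "pspan w (Suc k) = {v + of_nat n * w ^ k | v n. v \<in> pspan w k}"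

lemma zero_in_pspan: "0 \<in> pspan w k"
  by (induction k) (auto intro!: exI[of _ 0])

lemma pspan_add: "x \<in> pspan w k \<Longrightarrow> y \<in> pspan w k \<Longrightarrow> x + y \<in> pspan w k"
proof (induction k arbitrary: x y)
  case (Suc k)
  then obtain v n v' n' where "x = v + of_nat n * w ^ k" "y = v' + of_nat n' * w ^ k"
    "v \<in> pspan w k" "v' \<in> pspan w k"
    unfolding pspan.simps by blast
  moreover from this have "x + y = (v + v') + of_nat (n + n') * w ^ k"
    by (simp add: algebra_simps)
  ultimately show ?case
    unfolding pspan.simps using Suc.IH by blast
qed auto

lemma pspan_of_nat_mult: "x \<in> pspan w k \<Longrightarrow> of_nat n * x \<in> pspan w k"
  by (induction n) (auto simp: zero_in_pspan pspan_add distrib_right)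

lemma pspan_Suc: "pspan w k \<subseteq> pspan w (Suc k)" "w ^ k \<in> pspan w (Suc k)"
proof -
  have "v = v + of_nat 0 * w ^ k" for v by simp
  then show "pspan w k \<subseteq> pspan w (Suc k)"
    unfolding pspan.simps by blast
  show "w ^ k \<in> pspan w (Suc k)"
    using zero_in_pspan[of w k] by (auto intro!: exI[of _ 0] exI[of _ "Suc 0"])
qed

lemma pspan_mono: "j \<le> k \<Longrightarrow> pspan w j \<subseteq> pspan w k"
  by (induction rule: dec_induct) (use pspan_Suc in blast)+

lemma pspan_subset:
  assumes "0 \<in> S" "\<And>x y. x \<in> S \<Longrightarrow> y \<in> S \<Longrightarrow> x + y \<in> S" "\<And>j. j < k \<Longrightarrow> w ^ j \<in> S"
  shows "pspan w k \<subseteq> S"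
  using assms(3)
proof (induction k)
  case (Suc k)
  have "of_nat n * w ^ k \<in> S" for n
    by (induction n) (use Suc.prems assms in \<open>auto simp: distrib_right\<close>)
  then show ?case
    using Suc assms by (auto simp: less_Suc_eq)
qed (use assms in auto)

text \<open>Multiplication by \<open>w\<close> shifts the spanning powers by one, and only
  \<open>w ^ k\<close> could leave the span.\<close>

lemma pspan_mult_closed:
  assumes "w ^ k \<in> pspan w k" "x \<in> pspan w k"
  shows "w * x \<in> pspan w k"
proof -
  have "pspan w k \<subseteq> {x. w * x \<in> pspan w k}"
  proof (rule pspan_subset)
    fix j assume "j < k"
    then have "w ^ Suc j \<in> pspan w (Suc (Suc j))" "Suc j = k \<or> Suc (Suc j) \<le> k"
      using pspan_Suc(2)[of w "Suc j"] by auto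
    then show "w ^ j \<in> {x. w * x \<in> pspan w k}"
      using assms(1) pspan_mono[of "Suc (Suc j)" k w] by auto
  qed (auto simp: distrib_left zero_in_pspan pspan_add)
  with assms(2) show ?thesis by blast
qed

text \<open>Each new power multiplies the size by at least \<open>p\<close>: the sums
  \<open>v + n w ^ k\<close> with \<open>n < p\<close> are pairwise distinct.\<close>

lemma card_pspan:
  fixes w :: "'a::{finite, field}"
  assumes p: "prime p" "of_nat p = (0 :: 'a)" and new: "\<And>j. j < k \<Longrightarrow> w ^ j \<notin> pspan w j"
  shows "p ^ k \<le> card (pspan w k)"
  using new
proof (induction k)
  case (Suc k)
  let ?f = "\<lambda>(v, n). v + of_nat n * w ^ k"
  have less: "n' \<le> n" if v: "v \<in> pspan w k" "v' \<in> pspan w k" and n: "n' < p"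
    and eq: "v + of_nat n * w ^ k = v' + of_nat n' * w ^ k" for v v' n n'
  proof (rule ccontr)
    assume "\<not> n' \<le> n"
    then have lt: "n < n'" by simp
    define d where "d = n' - n"
    have "of_nat n' = (of_nat n + of_nat d :: 'a)"
      using lt by (simp add: d_def flip: of_nat_add)
    with eq have "of_nat d * w ^ k = v - v'"
      by (simp add: algebra_simps)
    \<comment> \<open>The span is closed under addition and natural multiples, so
      \<open>- v'\<close> is rewritten as \<open>(p - 1) v'\<close>.\<close>
    also have "\<dots> = v + of_nat (p - 1) * v'"
      using p prime_gt_0_nat[OF p(1)] by (simp add: of_nat_diff algebra_simps)
    finally have "of_nat d * w ^ k \<in> pspan w k"
      using v by (simp add: pspan_add pspan_of_nat_mult)
    \<comment> \<open>As \<open>0 < d < p\<close>, some \<open>e\<close> inverts \<open>d\<close>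
      modulo \<open>p\<close> and turns \<open>d w ^ k\<close> back into \<open>w ^ k\<close>, which
      would then not be new.\<close>
    moreover have "coprime d p"
      using lt n p(1) by (auto simp: d_def coprime_commute intro!: prime_imp_coprime dest: dvd_imp_le)
    then obtain e where "[d * e = Suc 0] (mod p)"
      using cong_solve_coprime_nat by blast
    then obtain s t where "d * e + p * s = 1 + p * t"
      by (metis cong_iff_lin_nat mult.commute One_nat_def)
    then have "of_nat (d * e + p * s) = (of_nat (1 + p * t) :: 'a)"
      by metis
    then have "of_nat e * of_nat d = (1 :: 'a)"
      using p(2) by (simp add: mult.commute)
    ultimately have "w ^ k \<in> pspan w k"
      using pspan_of_nat_mult[of "of_nat d * w ^ k" w k e] by (simp flip: mult.assoc)
    with Suc.prems show False by blast
  qed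
  have "inj_on ?f (pspan w k \<times> {..<p})"
  proof (rule inj_onI, clarsimp)
    fix v n v' n'
    assume *: "v \<in> pspan w k" "v' \<in> pspan w k" "n < p" "n' < p"
      "v + of_nat n * w ^ k = v' + of_nat n' * w ^ k"
    then have "n = n'"
      using less[of v v' n' n] less[of v' v n n'] by fastforce
    with * show "v = v' \<and> n = n'" by simp
  qed
  then have "card (pspan w k \<times> {..<p}) \<le> card (pspan w (Suc k))"
    by (intro card_inj_on_le[of ?f]) auto
  moreover have "p * p ^ k \<le> p * card (pspan w k)"
    using Suc by simp
  ultimately show ?case
    unfolding card_cartesian_product card_lessThan power_Suc by (metis le_trans mult.commute)
qed auto

text \<open>If each of \<open>w ^ 0\<close>, ..., \<open>w ^ a\<close> were independent of its
  predecessors, their span would have at least \<open>p ^ (a + 1)\<close> elements, more than the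
  field. So some \<open>w ^ k\<close> with \<open>k \<le> a\<close> lies in the span of the lower
  powers, which is then stable under \<open>w\<close> and contains every power.\<close>

lemma additive_generation_by_powers:
  fixes w :: "'a::{finite, field}"
  assumes p: "prime p" and card: "card (UNIV :: 'a set) = p ^ a"
    and prim: "\<forall>x::'a. x \<noteq> 0 \<longrightarrow> (\<exists>k::nat. x = w ^ k)"
    and S: "0 \<in> S" "\<And>x y. x \<in> S \<Longrightarrow> y \<in> S \<Longrightarrow> x + y \<in> S" "\<And>j. j \<le> a \<Longrightarrow> w ^ j \<in> S"
  shows "S = UNIV"
proof -
  have "of_nat p ^ a = (0 :: 'a)"
    using of_nat_card_eq_0[where 'a='a] card by simp
  then have p0: "of_nat p = (0 :: 'a)" by simp
  have "\<exists>k\<le>a. w ^ k \<in> pspan w k"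
  proof (rule ccontr)
    assume "\<not> ?thesis"
    then have "p ^ Suc a \<le> card (pspan w (Suc a))"
      by (intro card_pspan[OF p p0]) auto
    also have "\<dots> \<le> p ^ a"
      unfolding card[symmetric] by (rule card_mono) auto
    finally show False
      using prime_gt_1_nat[OF p] by simp
  qed
  then obtain k where k: "k \<le> a" "w ^ k \<in> pspan w k" by blast
  \<comment> \<open>\<open>pspan w 0\<close> is zero, so at least \<open>w ^ 0 = 1\<close> is among
    the spanning powers.\<close>
  have "k \<noteq> 0"
    using k(2) by (metis pspan.simps(1) power_0 singletonD zero_neq_one)
  then have "1 \<in> pspan w k"
    using pspan_Suc(2)[of w 0] pspan_mono[of "Suc 0" k w] by (auto simp del: pspan.simps)
  then have "w ^ n \<in> pspan w k" for n
    by (induction n) (auto intro: pspan_mult_closed k)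
  then have "x \<in> pspan w k" for x
    using prim zero_in_pspan[of w k] by metis
  moreover have "pspan w k \<subseteq> S"
    using S k(1) by (intro pspan_subset) auto
  ultimately show ?thesis by blast
qed

section \<open>Matrices over a finite index set\<close>

text \<open>An arbitrary index set serves both a single block \<open>{..<l i}\<close> and the full
  set \<open>blk_idx h l\<close>. Padding by zero makes matrices equal once their entries on
  \<open>I\<close> agree.\<close>

definition mmult :: "'i set \<Rightarrow> ('i \<Rightarrow> 'i \<Rightarrow> 'a::comm_ring_1) \<Rightarrow> ('i \<Rightarrow> 'i \<Rightarrow> 'a) \<Rightarrow> 'i \<Rightarrow> 'i \<Rightarrow> 'a" where
  "mmult I A B = (\<lambda>x y. if x \<in> I \<and> y \<in> I then \<Sum>z\<in>I. A x z * B z y else 0)"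

definition msupp :: "'i set \<Rightarrow> ('i \<Rightarrow> 'i \<Rightarrow> 'a::comm_ring_1) set" where
  "msupp I = {A. \<forall>x y. x \<notin> I \<or> y \<notin> I \<longrightarrow> A x y = 0}"

text \<open>Common form of transvections, dilations and the pivot columns split off in the
  elimination.\<close>

definition mcol :: "'i set \<Rightarrow> 'i \<Rightarrow> ('i \<Rightarrow> 'a::comm_ring_1) \<Rightarrow> 'i \<Rightarrow> 'i \<Rightarrow> 'a" where
  "mcol I x v = (\<lambda>u z. if u \<in> I \<and> z \<in> I then (if z = x then v u else if u = z then 1 else 0) else 0)"

definition mone :: "'i set \<Rightarrow> 'i \<Rightarrow> 'i \<Rightarrow> 'a::comm_ring_1" where
  "mone I = (\<lambda>u z. if u \<in> I \<and> u = z then 1 else 0)"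

definition transv :: "'i set \<Rightarrow> 'i \<Rightarrow> 'i \<Rightarrow> 'a::comm_ring_1 \<Rightarrow> 'i \<Rightarrow> 'i \<Rightarrow> 'a" where
  "transv I x y f = mcol I y ((\<lambda>u. if u = y then 1 else 0)(x := f))"

definition mdil :: "'i set \<Rightarrow> 'i \<Rightarrow> 'a::comm_ring_1 \<Rightarrow> 'i \<Rightarrow> 'i \<Rightarrow> 'a" where
  "mdil I x d = mcol I x ((\<lambda>u. 0)(x := d))"

text \<open>A permutation matrix; \<open>Transposition.transpose\<close> exchanges two indices and
  is unrelated to the transpose of a matrix.\<close>

definition mswap :: "'i set \<Rightarrow> 'i \<Rightarrow> 'i \<Rightarrow> 'i \<Rightarrow> 'i \<Rightarrow> 'a::comm_ring_1" where
  "mswap I x y = (\<lambda>u v. if u \<in> I \<and> v \<in> I \<and> v = Transposition.transpose x y u then 1 else 0)"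

lemma mmult_assoc: "mmult I (mmult I A B) C = mmult I A (mmult I B C)"
proof (intro ext)
  fix x y
  show "mmult I (mmult I A B) C x y = mmult I A (mmult I B C) x y"
  proof (cases "x \<in> I \<and> y \<in> I")
    case True
    have "(\<Sum>z\<in>I. (\<Sum>w\<in>I. A x w * B w z) * C z y) = (\<Sum>z\<in>I. \<Sum>w\<in>I. A x w * (B w z * C z y))"
      by (simp add: sum_distrib_right mult.assoc)
    also have "\<dots> = (\<Sum>w\<in>I. A x w * (\<Sum>z\<in>I. B w z * C z y))"
      by (subst sum.swap) (simp add: sum_distrib_left)
    finally show ?thesis
      using True by (simp add: mmult_def)
  qed (auto simp: mmult_def)
qed

lemma msupp_intros [simp]:
  "mmult I A B \<in> msupp I" "mcol I x v \<in> msupp I" "mone I \<in> msupp I" "transv I x y f \<in> msupp I"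
  "mdil I x d \<in> msupp I" "mswap I x y \<in> msupp I"
  by (auto simp: msupp_def mmult_def mcol_def mone_def transv_def mdil_def mswap_def)

lemma msupp_eqI:
  assumes "A \<in> msupp I" "B \<in> msupp I" "\<And>x y. x \<in> I \<Longrightarrow> y \<in> I \<Longrightarrow> A x y = B x y"
  shows "A = B"
proof (intro ext)
  fix x y show "A x y = B x y"
    using assms by (cases "x \<in> I \<and> y \<in> I") (auto simp: msupp_def)
qed

section \<open>Elementary matrices and the relations between them\<close>

context
  fixes I :: "'i set"
  assumes fin: "finite I"
begin

lemma mcol_mult:
  assumes "x \<in> I" "u \<in> I" "z \<in> I"
  shows "mmult I (mcol I x v) A u z = (if u = x then 0 else A u z) + v u * A x z"
proof -
  have "(\<Sum>k\<in>I. mcol I x v u k * A k z)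
    = (\<Sum>k\<in>I. (if k = x then v u * A x z else 0) + (if k = u then (if u = x then 0 else A u z) else 0))"
    using assms by (intro sum.cong) (auto simp: mcol_def)
  also have "\<dots> = v u * A x z + (if u = x then 0 else A u z)"
    using assms fin by (simp add: sum.distrib)
  finally show ?thesis
    using assms by (simp add: mmult_def)
qed

lemma mone_mult: "A \<in> msupp I \<Longrightarrow> mmult I (mone I) A = A"
  by (rule msupp_eqI[of _ I], simp_all)
    (use fin in \<open>simp_all add: mmult_def mone_def if_distrib[of "\<lambda>x. x * _"] cong: if_cong\<close>)

lemma mult_mone: "A \<in> msupp I \<Longrightarrow> mmult I A (mone I) = A"
  by (rule msupp_eqI[of _ I], simp_all)
    (use fin in \<open>simp_all add: mmult_def mone_def if_distrib[of "\<lambda>x. _ * x"] cong: if_cong\<close>)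

lemma transv_mult:
  assumes "x \<in> I" "y \<in> I" "x \<noteq> y" "u \<in> I" "z \<in> I"
  shows "mmult I (transv I x y f) A u z = A u z + (if u = x then f * A y z else 0)"
  using assms by (auto simp: transv_def mcol_mult)

lemma mdil_mult:
  assumes "x \<in> I" "u \<in> I" "z \<in> I"
  shows "mmult I (mdil I x d) A u z = (if u = x then d * A x z else A u z)"
  using assms by (auto simp: mdil_def mcol_mult)

lemma transv_add:
  assumes "x \<in> I" "y \<in> I" "x \<noteq> y"
  shows "mmult I (transv I x y f) (transv I x y g) = transv I x y (f + g)"
  by (rule msupp_eqI[of _ I]) (use assms in \<open>auto simp: transv_mult\<close>, auto simp: transv_def mcol_def)

lemma transv_0: "y \<in> I \<Longrightarrow> x \<noteq> y \<Longrightarrow> transv I x y 0 = mone I"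
  by (auto simp: transv_def mcol_def mone_def fun_eq_iff)

lemma mdil_1: "mdil I x 1 = mone I"
  by (auto simp: mdil_def mcol_def mone_def fun_eq_iff)

lemma mdil_mdil: "x \<in> I \<Longrightarrow> mmult I (mdil I x d) (mdil I x e) = mdil I x (d * e)"
  by (rule msupp_eqI[of _ I]) (auto simp: mdil_mult, auto simp: mdil_def mcol_def)

text \<open>Conjugation by a dilation scales the transvection. No inverse is written, since
  \<open>d\<close> may be invertible only modulo a power of \<open>t\<close>.\<close>

lemma mdil_transv:
  assumes "x \<in> I" "y \<in> I" "x \<noteq> y"
  shows "mmult I (mdil I x d) (transv I x y f) = mmult I (transv I x y (d * f)) (mdil I x d)"
  by (rule msupp_eqI[of _ I]) (use assms in \<open>auto simp: transv_mult mdil_mult\<close>, auto simp: mdil_def transv_def mcol_def)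

text \<open>The commutator relation, arranged so that it holds without inverses.\<close>

lemma transv_commutator:
  assumes "x \<in> I" "y \<in> I" "z \<in> I" "x \<noteq> y" "y \<noteq> z" "x \<noteq> z"
  shows "mmult I (transv I x y f) (transv I y z g)
       = mmult I (transv I x z (f * g)) (mmult I (transv I y z g) (transv I x y f))"
  by (rule msupp_eqI[of _ I]) (use assms in \<open>auto simp: transv_mult\<close>, auto simp: transv_def mcol_def)

lemma transpose_mem: "x \<in> I \<Longrightarrow> y \<in> I \<Longrightarrow> Transposition.transpose x y u \<in> I \<longleftrightarrow> u \<in> I"
  by (auto simp: Transposition.transpose_def)

lemma mswap_mult:
  assumes "x \<in> I" "y \<in> I" "u \<in> I" "z \<in> I"
  shows "mmult I (mswap I x y) A u z = A (Transposition.transpose x y u) z"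
proof -
  have "(\<Sum>k\<in>I. mswap I x y u k * A k z)
    = (\<Sum>k\<in>I. if k = Transposition.transpose x y u then A k z else 0)"
    using assms by (intro sum.cong) (auto simp: mswap_def)
  also have "\<dots> = A (Transposition.transpose x y u) z"
    using assms fin by (simp add: transpose_mem)
  finally show ?thesis
    using assms by (simp add: mmult_def)
qed

lemma mult_mswap:
  assumes "x \<in> I" "y \<in> I" "u \<in> I" "z \<in> I"
  shows "mmult I A (mswap I x y) u z = A u (Transposition.transpose x y z)"
proof -
  have "(\<Sum>k\<in>I. A u k * mswap I x y k z)
    = (\<Sum>k\<in>I. if k = Transposition.transpose x y z then A u k else 0)"
    using assms by (intro sum.cong) (auto simp: mswap_def)
  also have "\<dots> = A u (Transposition.transpose x y z)"
    using assms fin by (simp add: transpose_mem)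
  finally show ?thesis
    using assms by (simp add: mmult_def)
qed

lemma mswap_mswap: "x \<in> I \<Longrightarrow> y \<in> I \<Longrightarrow> mmult I (mswap I x y) (mswap I x y) = mone I"
  by (rule msupp_eqI[of _ I]) (auto simp: mswap_mult, auto simp: mswap_def mone_def transpose_mem)

text \<open>Conjugation by a permutation matrix relabels the indices.\<close>

lemma mswap_transv:
  assumes "x \<in> I" "y \<in> I" "u \<in> I" "v \<in> I" "u \<noteq> v"
  shows "mmult I (mswap I x y) (transv I u v f)
       = mmult I (transv I (Transposition.transpose x y u) (Transposition.transpose x y v) f) (mswap I x y)"
    (is "mmult I ?A ?B = mmult I ?C ?A")
proof (rule msupp_eqI[of _ I])
  fix s t assume "s \<in> I" "t \<in> I"
  moreover have [simp]: "Transposition.transpose x y s = w \<longleftrightarrow> s = Transposition.transpose x y w" for s w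
    by (metis transpose_involutory)
  ultimately show "mmult I ?A ?B s t = mmult I ?C ?A s t"
    using assms by (simp add: mswap_mult mult_mswap transpose_mem transv_def mcol_def)
qed auto

lemma mswap_mdil:
  assumes "x \<in> I" "y \<in> I" "u \<in> I"
  shows "mmult I (mswap I x y) (mdil I u d) = mmult I (mdil I (Transposition.transpose x y u) d) (mswap I x y)"
    (is "mmult I ?A ?B = mmult I ?C ?A")
proof (rule msupp_eqI[of _ I])
  fix s t assume "s \<in> I" "t \<in> I"
  moreover have [simp]: "Transposition.transpose x y s = w \<longleftrightarrow> s = Transposition.transpose x y w" for s w
    by (metis transpose_involutory)
  ultimately show "mmult I ?A ?B s t = mmult I ?C ?A s t"
    using assms by (simp add: mswap_mult mult_mswap transpose_mem mdil_def mcol_def)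
qed auto

text \<open>The right factor adds \<open>f\<close> times column \<open>y\<close> to column
  \<open>x\<close>; column \<open>y\<close> is still a unit vector, so just the entry in row
  \<open>y\<close> is filled in.\<close>

lemma mcol_transv:
  assumes "x \<in> I" "y \<in> I" "x \<noteq> y" "v y = 0"
  shows "mmult I (mcol I x v) (transv I y x f) = mcol I x (v(y := f))"
  by (rule msupp_eqI[of _ I]) (use assms in \<open>auto simp: mcol_mult\<close>, auto simp: transv_def mcol_def)

end

section \<open>Lifting the algebra to polynomial matrices\<close>

lemma sum_const_poly: "(\<Sum>r<(n::nat). [:f r:]) = [:\<Sum>r<n. f r :: 'a::comm_ring_1:]"
  by (induction n) auto

lemma sum_blk_row:
  assumes "i < h"
  shows "(\<Sum>z\<in>blk_idx h l. if fst z = i then g z else 0) = (\<Sum>r<l i. g (i, r))"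
proof -
  have "finite (blk_idx h l)"
    by (rule finite_subset[of _ "SIGMA i:{..<h}. {..<l i}"]) (auto simp: blk_idx_def)
  moreover have "{z \<in> blk_idx h l. fst z = i} = Pair i ` {..<l i}"
    using assms by (auto simp: blk_idx_def)
  ultimately show ?thesis
    by (simp add: sum.inter_filter[symmetric] sum.reindex inj_on_def)
qed

locale lam_blocks =
  fixes h :: nat and lam l :: "nat \<Rightarrow> nat"
  assumes lam_Suc: "\<And>i. i + 1 < h \<Longrightarrow> lam i < lam (i + 1)"
    and lam_pos: "\<And>i. i < h \<Longrightarrow> 0 < lam i"
    and l_pos: "\<And>i. i < h \<Longrightarrow> 0 < l i"
begin

abbreviation I :: "(nat \<times> nat) set" where
  "I \<equiv> blk_idx h l"

abbreviation gap :: "nat \<times> nat \<Rightarrow> nat \<times> nat \<Rightarrow> nat" where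
  "gap x y \<equiv> lam (fst y) - lam (fst x)"

text \<open>Entries are not reduced, so products can be taken over the polynomial ring. Truncated
  subtraction makes the condition void when the column block has the smaller or equal
  \<open>lam\<close>.\<close>

definition adm :: "(nat \<times> nat \<Rightarrow> nat \<times> nat \<Rightarrow> 'a::field poly) set" where
  "adm = {A \<in> msupp I. \<forall>x\<in>I. \<forall>y\<in>I. tpow (gap x y) dvd A x y}"

definition red :: "(nat \<times> nat \<Rightarrow> nat \<times> nat \<Rightarrow> 'a::field poly) \<Rightarrow> nat \<times> nat \<Rightarrow> nat \<times> nat \<Rightarrow> 'a poly" where
  "red A = (\<lambda>x y. if x \<in> I \<and> y \<in> I then A x y mod tpow (lam (fst y)) else 0)"

lemma finite_I [simp]: "finite I"
  by (rule finite_subset[of _ "SIGMA i:{..<h}. {..<l i}"]) (auto simp: blk_idx_def)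

lemma I_fst: "x \<in> I \<Longrightarrow> fst x < h"
  by (auto simp: blk_idx_def)

lemma lam_less: "i < j \<Longrightarrow> j < h \<Longrightarrow> lam i < lam j"
proof (induction j)
  case (Suc j)
  then show ?case
    using lam_Suc[of j] by (cases "i = j") auto
qed auto

lemma lam_le: "i \<le> j \<Longrightarrow> j < h \<Longrightarrow> lam i \<le> lam j"
  using lam_less[of i j] by (cases "i = j") auto

lemma I_lam_pos: "x \<in> I \<Longrightarrow> 0 < lam (fst x)"
  using lam_pos I_fst by blast

lemma pair_I_lam_pos: "(i, r) \<in> I \<Longrightarrow> 0 < lam i"
  using I_lam_pos by fastforce

lemma red_eq_iff:
  "red A = red B \<longleftrightarrow> (\<forall>x\<in>I. \<forall>y\<in>I. tpow (lam (fst y)) dvd A x y - B x y)"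
  unfolding red_def fun_eq_iff mod_eq_dvd_iff[symmetric] by meson

lemma admD: "A \<in> adm \<Longrightarrow> x \<in> I \<Longrightarrow> y \<in> I \<Longrightarrow> tpow (gap x y) dvd A x y"
  by (simp add: adm_def)

lemma adm_msupp: "A \<in> adm \<Longrightarrow> A \<in> msupp I"
  by (simp add: adm_def)

text \<open>Truncated differences satisfy the triangle inequality
  \<open>gap x z \<le> gap x y + gap y z\<close>.\<close>

lemma tpow_gap_mult:
  assumes "tpow (gap x y) dvd f" "tpow (gap y z) dvd g"
  shows "tpow (gap x z) dvd (f * g :: 'a::field poly)"
proof -
  have "tpow (gap x z) dvd (tpow (gap x y + gap y z) :: 'a poly)"
    by (rule tpow_dvd_tpow) simp
  then show ?thesis
    using mult_dvd_mono[OF assms] by (metis dvd_trans tpow_add)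
qed

text \<open>Since \<open>lam (fst z) \<le> lam (fst y) + gap y z\<close>, an error modulo the column
  modulus of \<open>y\<close> becomes an error modulo that of \<open>z\<close> after multiplication
  by an admissible entry.\<close>

lemma tpow_lam_mult:
  assumes "tpow (lam (fst y)) dvd f" "tpow (gap y z) dvd g"
  shows "tpow (lam (fst z)) dvd (f * g :: 'a::field poly)"
proof -
  have "tpow (lam (fst z)) dvd (tpow (lam (fst y) + gap y z) :: 'a poly)"
    by (rule tpow_dvd_tpow) simp
  then show ?thesis
    using mult_dvd_mono[OF assms] by (metis dvd_trans tpow_add)
qed

lemma adm_mult:
  assumes "A \<in> adm" "B \<in> adm"
  shows "mmult I A B \<in> adm"
proof -
  have "tpow (gap x y) dvd mmult I A B x y" if "x \<in> I" "y \<in> I" for x y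
    unfolding mmult_def using that assms
    by (simp, intro dvd_sum, metis admD tpow_gap_mult)
  then show ?thesis
    by (simp add: adm_def)
qed

text \<open>The error of each summand splits as \<open>(red A - A) B + red A (red B - B)\<close>;
  admissibility of \<open>B\<close> controls the first term, and the second is already zero modulo
  the column modulus.\<close>

lemma red_mult:
  assumes "B \<in> adm"
  shows "red (mmult I (red A) (red B)) = red (mmult I A B)"
  unfolding red_eq_iff
proof (intro ballI)
  fix x y assume xy: "x \<in> I" "y \<in> I"
  have "tpow (lam (fst y)) dvd red A x z * red B z y - A x z * B z y" if "z \<in> I" for z
  proof -
    have "tpow (lam (fst z)) dvd red A x z - A x z" "tpow (lam (fst y)) dvd red B z y - B z y"
      using xy that by (auto simp: red_def simp flip: mod_eq_dvd_iff)
    then have "tpow (lam (fst y)) dvd (red A x z - A x z) * B z y"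
      "tpow (lam (fst y)) dvd red A x z * (red B z y - B z y)"
      using tpow_lam_mult admD[OF assms that xy(2)] by auto
    then have "tpow (lam (fst y)) dvd (red A x z - A x z) * B z y + red A x z * (red B z y - B z y)"
      by (rule dvd_add)
    then show ?thesis by (simp add: algebra_simps)
  qed
  then show "tpow (lam (fst y)) dvd mmult I (red A) (red B) x y - mmult I A B x y"
    using xy by (auto simp: mmult_def sum_subtractf[symmetric] intro!: dvd_sum)
qed

lemma red_carrier: "A \<in> adm \<Longrightarrow> red A \<in> lam_carrier h lam l"
  unfolding lam_carrier_def red_def
  by (simp add: admD dvd_mod tpow_dvd_tpow)

lemma lam_carrier_adm: "A \<in> lam_carrier h lam l \<Longrightarrow> A \<in> adm"
  unfolding lam_carrier_def adm_def msupp_def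
proof clarsimp
  fix i r j s
  assume "\<forall>x\<in>I. \<forall>y\<in>I. A x y mod tpow (lam (fst y)) = A x y \<and>
      (fst x < fst y \<longrightarrow> tpow (gap x y) dvd A x y)" and ij: "(i, r) \<in> I" "(j, s) \<in> I"
  then have "i < j \<longrightarrow> tpow (lam j - lam i) dvd A (i, r) (j, s)" by fastforce
  moreover have "lam j - lam i = 0" if "\<not> i < j"
    using lam_le[of j i] I_fst[OF ij(1)] that by auto
  ultimately show "tpow (lam j - lam i) dvd A (i, r) (j, s)"
    by (cases "i < j") auto
qed

lemma red_id: "A \<in> lam_carrier h lam l \<Longrightarrow> red A = A"
  unfolding red_def lam_carrier_def fun_eq_iff mem_Collect_eq by metis

lemma lam_mult_red: "lam_mult h lam l A B = red (mmult I A B)"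
  by (auto simp: lam_mult_def red_def mmult_def fun_eq_iff)

lemma lam_mult_red_red: "B \<in> adm \<Longrightarrow> lam_mult h lam l (red A) (red B) = red (mmult I A B)"
  by (simp add: lam_mult_red red_mult)

lemma mone_adm: "mone I \<in> adm"
  by (auto simp: adm_def mone_def msupp_def)

lemma lam_one_eq: "lam_one h l = mone I"
  by (simp add: lam_one_def mone_def)

lemma red_mone: "red (mone I) = mone I"
  unfolding red_def mone_def fun_eq_iff by (simp add: mod_tpow_one pair_I_lam_pos)

lemma mone_carrier: "mone I \<in> lam_carrier h lam l"
  using red_carrier[OF mone_adm] by (simp add: red_mone)

section \<open>The monoid of reduced matrices and its group of units\<close>

lemma monoid_lam_alg: "Group.monoid (lam_alg h lam l :: (nat \<times> nat \<Rightarrow> nat \<times> nat \<Rightarrow> 'a::field poly) monoid)"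
proof (rule Group.monoidI)
  fix A B C :: "nat \<times> nat \<Rightarrow> nat \<times> nat \<Rightarrow> 'a poly"
  assume "A \<in> carrier (lam_alg h lam l)" "B \<in> carrier (lam_alg h lam l)" "C \<in> carrier (lam_alg h lam l)"
  then have c: "A \<in> lam_carrier h lam l" "B \<in> lam_carrier h lam l" "C \<in> lam_carrier h lam l"
    by (simp_all add: lam_alg_def)
  note adm = c[THEN lam_carrier_adm]
  show "A \<otimes>\<^bsub>lam_alg h lam l\<^esub> B \<in> carrier (lam_alg h lam l)"
    using adm by (simp add: lam_alg_def lam_mult_red red_carrier adm_mult)
  \<comment> \<open>Both bracketings reduce to the triple product over the polynomial ring, which is
    associative.\<close>
  have "red (mmult I (red (mmult I A B)) (red C)) = red (mmult I (red A) (red (mmult I B C)))"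
    using adm by (simp add: red_mult adm_mult mmult_assoc)
  then show "A \<otimes>\<^bsub>lam_alg h lam l\<^esub> B \<otimes>\<^bsub>lam_alg h lam l\<^esub> C
      = A \<otimes>\<^bsub>lam_alg h lam l\<^esub> (B \<otimes>\<^bsub>lam_alg h lam l\<^esub> C)"
    using c by (simp add: lam_alg_def lam_mult_red red_id)
next
  fix A :: "nat \<times> nat \<Rightarrow> nat \<times> nat \<Rightarrow> 'a poly" assume "A \<in> carrier (lam_alg h lam l)"
  then have A: "A \<in> lam_carrier h lam l"
    by (simp add: lam_alg_def)
  note As = adm_msupp[OF lam_carrier_adm[OF A]]
  show "\<one>\<^bsub>lam_alg h lam l\<^esub> \<otimes>\<^bsub>lam_alg h lam l\<^esub> A = A" "A \<otimes>\<^bsub>lam_alg h lam l\<^esub> \<one>\<^bsub>lam_alg h lam l\<^esub> = A"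
    by (simp_all add: lam_alg_def lam_mult_red lam_one_eq mone_mult[OF finite_I As] mult_mone[OF finite_I As] red_id A)
qed (simp add: lam_alg_def lam_one_eq mone_carrier)

lemma group_lam_units: "Group.group (lam_units h lam l)"
  unfolding lam_units_def by (rule Group.monoid.units_group[OF monoid_lam_alg])

lemma lam_units_simps:
  "x \<otimes>\<^bsub>lam_units h lam l\<^esub> y = lam_mult h lam l x y" "\<one>\<^bsub>lam_units h lam l\<^esub> = mone I"
  by (simp_all add: lam_units_def units_of_def lam_alg_def lam_one_eq)

lemma lam_units_carrier_iff:
  "A \<in> carrier (lam_units h lam l) \<longleftrightarrow> A \<in> lam_carrier h lam l \<and>
    (\<exists>B\<in>lam_carrier h lam l. red (mmult I B A) = mone I \<and> red (mmult I A B) = mone I)"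
  by (simp add: lam_units_def units_of_def Units_def lam_alg_def lam_mult_red lam_one_eq)

lemma red_in_units:
  assumes "A \<in> adm" "B \<in> adm" "red (mmult I A B) = mone I" "red (mmult I B A) = mone I"
  shows "red A \<in> carrier (lam_units h lam l)"
  using assms by (auto simp: lam_units_carrier_iff red_carrier red_mult intro!: bexI[of _ "red B"])

subsection \<open>Admissible elementary matrices\<close>

lemma adm_mcol:
  assumes "x \<in> I" "\<And>u. u \<in> I \<Longrightarrow> tpow (gap u x) dvd v u"
  shows "mcol I x v \<in> adm"
  unfolding adm_def using assms by (auto simp: mcol_def msupp_def)

lemma adm_transv_iff:
  assumes "x \<in> I" "y \<in> I" "x \<noteq> y"
  shows "transv I x y f \<in> adm \<longleftrightarrow> tpow (gap x y) dvd f"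
proof
  assume "transv I x y f \<in> adm"
  from admD[OF this assms(1,2)] show "tpow (gap x y) dvd f"
    using assms by (simp add: transv_def mcol_def)
qed (use assms in \<open>auto simp: transv_def intro!: adm_mcol\<close>)

lemma adm_mdil: "x \<in> I \<Longrightarrow> mdil I x d \<in> adm"
  unfolding mdil_def by (rule adm_mcol) auto

lemma adm_elem_a: "elem_a h l i (const_mat y) \<in> adm"
  unfolding adm_def msupp_def elem_a_def by auto

lemma elem_a_msupp: "elem_a h l i y \<in> msupp I"
  unfolding msupp_def elem_a_def by auto

lemma red_elem_a: "red (elem_a h l i (const_mat y)) = elem_a h l i (const_mat y)"
  by (auto simp: red_def elem_a_def const_mat_def fun_eq_iff mod_tpow_const mod_tpow_one pair_I_lam_pos)

lemma elem_a_mult: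
  assumes i: "i < h"
  shows "mmult I (elem_a h l i (const_mat y)) (elem_a h l i (const_mat z))
    = elem_a h l i (const_mat (mmult {..<l i} y z))"
proof (rule msupp_eqI[of _ I])
  fix u v assume u: "u \<in> I" and v: "v \<in> I"
  let ?A = "elem_a h l i (const_mat y)" and ?B = "elem_a h l i (const_mat z)"
  show "mmult I ?A ?B u v = elem_a h l i (const_mat (mmult {..<l i} y z)) u v"
  proof (cases "fst u = i")
    case True
    \<comment> \<open>A row of \<open>?A\<close> in block \<open>i\<close> vanishes outside the
      columns of block \<open>i\<close>.\<close>
    have "mmult I ?A ?B u v = (\<Sum>w\<in>I. if fst w = i then [:y (snd u) (snd w):] * ?B w v else 0)"
      unfolding mmult_def using u v True
      by (simp, intro sum.cong) (auto simp: elem_a_def const_mat_def)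
    also have "\<dots> = (\<Sum>r<l i. [:y (snd u) r:] * ?B (i, r) v)"
      by (simp add: sum_blk_row[OF i])
    also have "\<dots> = elem_a h l i (const_mat (mmult {..<l i} y z)) u v"
    proof (cases "fst v = i")
      case v': True
      have "(\<Sum>r<l i. [:y (snd u) r:] * ?B (i, r) v) = (\<Sum>r<l i. [:y (snd u) r * z r (snd v):])"
        using i v v' by (intro sum.cong) (auto simp: elem_a_def const_mat_def blk_idx_def)
      also have "\<dots> = [:\<Sum>r<l i. y (snd u) r * z r (snd v):]"
        by (rule sum_const_poly)
      finally show ?thesis
        using u v True v' by (auto simp: elem_a_def const_mat_def mmult_def blk_idx_def)
    next
      case v': False
      then have "(\<Sum>r<l i. [:y (snd u) r:] * ?B (i, r) v) = 0"
        by (intro sum.neutral) (auto simp: elem_a_def)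
      with v' True show ?thesis
        by (auto simp: elem_a_def)
    qed
    finally show ?thesis .
  next
    case False
    have "mmult I ?A ?B u v = (\<Sum>w\<in>I. ?A u w * ?B w v)"
      using u v by (simp add: mmult_def)
    also have "\<dots> = (\<Sum>w\<in>I. if w = u then ?B w v else 0)"
      using u False by (intro sum.cong) (auto simp: elem_a_def)
    finally show ?thesis
      using u v False by (auto simp: elem_a_def)
  qed
qed (simp_all add: elem_a_msupp)

lemma elem_a_mone: "elem_a h l i (const_mat (mone {..<l i})) = mone I"
  by (auto simp: elem_a_def const_mat_def mone_def fun_eq_iff blk_idx_def one_pCons)

lemma elem_a_transv:
  assumes "i < h" "r < l i" "s < l i" "r \<noteq> s"
  shows "elem_a h l i (const_mat (transv {..<l i} r s c)) = transv I (i, r) (i, s) [:c:]"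
  using assms by (auto simp: elem_a_def const_mat_def transv_def mcol_def fun_eq_iff blk_idx_def one_pCons)

lemma elem_a_mdil:
  assumes "i < h" "r < l i"
  shows "elem_a h l i (const_mat (mdil {..<l i} r c)) = mdil I (i, r) [:c:]"
  using assms by (auto simp: elem_a_def const_mat_def mdil_def mcol_def fun_eq_iff blk_idx_def one_pCons)

lemma elem_a_mswap:
  assumes "i < h" "r < l i" "s < l i"
  shows "elem_a h l i (const_mat (mswap {..<l i} r s)) = mswap I (i, r) (i, s)"
  using assms
  by (auto simp: elem_a_def const_mat_def mswap_def fun_eq_iff blk_idx_def one_pCons Transposition.transpose_def)

lemma elem_b_mdil: "i < h \<Longrightarrow> elem_b h l i d = mdil I (i, 0) d"
  using l_pos by (auto simp: elem_b_def lam_one_def mdil_def mcol_def fun_eq_iff blk_idx_def)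

text \<open>The bottom-left corner sits in row \<open>l i - 1\<close> and column 0; positivity of
  \<open>l i\<close> makes this a genuine position, distinct from the diagonal.\<close>

lemma elem_cplus_transv:
  "i + 1 < h \<Longrightarrow> elem_cplus h lam l i = transv I (i, l i - 1) (i + 1, 0) (tpow (lam (i + 1) - lam i))"
  using l_pos[of i] l_pos[of "i + 1"]
  by (auto simp: elem_cplus_def lam_one_def transv_def mcol_def fun_eq_iff blk_idx_def)

lemma elem_cminus_transv:
  "i + 1 < h \<Longrightarrow> elem_cminus h l i = transv I (i + 1, 0) (i, l i - 1) 1"
  using l_pos[of i] l_pos[of "i + 1"]
  by (auto simp: elem_cminus_def lam_one_def transv_def mcol_def fun_eq_iff blk_idx_def)

end

section \<open>General linear groups as groups of units\<close>

lemma matrix_monoid_eqs: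
  "mat_carrier n = msupp {..<n}" "mat_mult n = mmult {..<n}" "mat_one n = mone {..<n}"
  by (auto simp: mat_carrier_def msupp_def mat_mult_def mmult_def mat_one_def mone_def fun_eq_iff not_less)

lemma GL_grp_carrier_iff:
  "A \<in> carrier (GL_grp n) \<longleftrightarrow> A \<in> msupp {..<n} \<and>
    (\<exists>B\<in>msupp {..<n}. mmult {..<n} B A = mone {..<n} \<and> mmult {..<n} A B = mone {..<n})"
  by (simp add: GL_grp_def units_of_def Units_def matrix_monoid_eqs matrix_monoid_def)

lemma group_GL_grp: "Group.group (GL_grp n)"
proof -
  have "Group.monoid (matrix_monoid n)"
    by (intro Group.monoidI) (auto simp: matrix_monoid_def matrix_monoid_eqs mmult_assoc mone_mult mult_mone)
  then show ?thesis
    unfolding GL_grp_def by (rule Group.monoid.units_group)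
qed

lemma GL_grp_simps:
  "x \<otimes>\<^bsub>GL_grp n\<^esub> y = mmult {..<n} x y" "\<one>\<^bsub>GL_grp n\<^esub> = mone {..<n}"
  by (auto simp: GL_grp_def units_of_def matrix_monoid_def matrix_monoid_eqs)

lemma transv_GL: "r < n \<Longrightarrow> s < n \<Longrightarrow> r \<noteq> s \<Longrightarrow> transv {..<n} r s c \<in> carrier (GL_grp n)"
  unfolding GL_grp_carrier_iff
  by (auto simp: transv_add transv_0 intro!: bexI[of _ "transv {..<n} r s (- c)"])

lemma mdil_GL: "r < n \<Longrightarrow> c \<noteq> 0 \<Longrightarrow> mdil {..<n} r (c :: 'a::field) \<in> carrier (GL_grp n)"
  unfolding GL_grp_carrier_iff
  by (auto simp: mdil_mdil mdil_1 intro!: bexI[of _ "mdil {..<n} r (1 / c)"])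

lemma mswap_GL: "r < n \<Longrightarrow> s < n \<Longrightarrow> mswap {..<n} r s \<in> carrier (GL_grp n)"
  unfolding GL_grp_carrier_iff
  by (auto simp: mswap_mswap intro!: bexI[of _ "mswap {..<n} r s"])

section \<open>Subgroups containing the generators\<close>

text \<open>Isolates what the elimination uses of the generated subgroup. \<open>W\<close> stands
  for the powers of the primitive element, of which only additive generation of the field
  matters.\<close>

locale lam_generation = lam_blocks h lam l
  for h :: nat and lam l :: "nat \<Rightarrow> nat" +
  fixes G :: "(nat \<times> nat \<Rightarrow> nat \<times> nat \<Rightarrow> 'a::field poly) set" and W :: "'a set"
  assumes subgroup_G: "subgroup G (lam_units h lam l)"
    and W_spans: "\<And>S. 0 \<in> S \<Longrightarrow> (\<And>x y. x \<in> S \<Longrightarrow> y \<in> S \<Longrightarrow> x + y \<in> S) \<Longrightarrow> W \<subseteq> S \<Longrightarrow> S = UNIV"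
    and elem_a_in: "\<And>i y. i < h \<Longrightarrow> y \<in> carrier (GL_grp (l i)) \<Longrightarrow> elem_a h l i (const_mat y) \<in> G"
    and elem_b_in: "\<And>i c k. i < h \<Longrightarrow> c \<in> W \<Longrightarrow> 1 \<le> k \<Longrightarrow> k < lam i \<Longrightarrow> elem_b h l i (1 + monom c k) \<in> G"
    and elem_cplus_in: "\<And>i. i + 1 < h \<Longrightarrow> elem_cplus h lam l i \<in> G"
    and elem_cminus_in: "\<And>i. i + 1 < h \<Longrightarrow> elem_cminus h l i \<in> G"
begin

text \<open>Membership in \<open>G\<close> is tested on the reduction, so a lift may be invertible
  only after reduction.\<close>

definition lifted :: "(nat \<times> nat \<Rightarrow> nat \<times> nat \<Rightarrow> 'a poly) \<Rightarrow> bool" where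
  "lifted A \<longleftrightarrow> A \<in> adm \<and> red A \<in> G"

lemma lifted_adm: "lifted A \<Longrightarrow> A \<in> adm"
  by (simp add: lifted_def)

lemma lifted_cong: "lifted B \<Longrightarrow> A \<in> adm \<Longrightarrow> red A = red B \<Longrightarrow> lifted A"
  by (simp add: lifted_def)

lemma lifted_of_mem: "A \<in> G \<Longrightarrow> lifted A"
  using subgroup.subset[OF subgroup_G] lam_units_carrier_iff lam_carrier_adm red_id
  unfolding lifted_def by (metis subsetD)

lemma lifted_mone: "lifted (mone I)"
  using subgroup.one_closed[OF subgroup_G] by (intro lifted_of_mem) (simp add: lam_units_simps)

lemma lifted_mult: "lifted A \<Longrightarrow> lifted B \<Longrightarrow> lifted (mmult I A B)"
  using subgroup.m_closed[OF subgroup_G, of "red A" "red B"]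
  by (simp add: lifted_def adm_mult lam_units_simps lam_mult_red_red)

lemma lifted_inverse:
  assumes "lifted A"
  obtains B where "lifted B" "red (mmult I A B) = mone I" "red (mmult I B A) = mone I"
proof -
  interpret U: Group.group "lam_units h lam l"
    by (rule group_lam_units)
  have A: "red A \<in> G" "A \<in> adm"
    using assms by (auto simp: lifted_def)
  then have Ac: "red A \<in> carrier (lam_units h lam l)"
    using subgroup.subset[OF subgroup_G] by blast
  define B where "B = inv\<^bsub>lam_units h lam l\<^esub> red A"
  have "B \<in> G"
    using A subgroup.m_inv_closed[OF subgroup_G] by (simp add: B_def)
  then have B: "lifted B" "red B = B"
    using lifted_of_mem subgroup.subset[OF subgroup_G] lam_units_carrier_iff red_id
    by (blast, metis subsetD)
  have "lam_mult h lam l (red A) (red B) = mone I" "lam_mult h lam l (red B) (red A) = mone I"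
    using U.r_inv[OF Ac] U.l_inv[OF Ac] unfolding B(2) by (auto simp: B_def lam_units_simps)
  then show ?thesis
    using that[OF B(1)] A lam_mult_red_red lifted_adm[OF B(1)] by metis
qed

lemma red_mult_cong:
  "B \<in> adm \<Longrightarrow> B' \<in> adm \<Longrightarrow> red A = red A' \<Longrightarrow> red B = red B' \<Longrightarrow> red (mmult I A B) = red (mmult I A' B')"
  by (metis red_mult)

text \<open>Turns a relation \<open>X Y = Z X\<close> into closure under conjugation: if
  \<open>X\<close> and \<open>Y\<close> are lifted, so is an admissible \<open>Z\<close>.\<close>

lemma lifted_cancel_right:
  assumes "lifted (mmult I A B)" "lifted B" "A \<in> adm"
  shows "lifted A"
proof -
  obtain C where C: "lifted C" "red (mmult I B C) = mone I"
    using lifted_inverse[OF assms(2)] by blast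
  have "red (mmult I (mmult I A B) C) = red (mmult I A (mone I))"
    unfolding mmult_assoc
    by (rule red_mult_cong) (use assms C in \<open>auto simp: adm_mult lifted_adm mone_adm red_mone\<close>)
  then have "red A = red (mmult I (mmult I A B) C)"
    using assms(3) by (simp add: mult_mone adm_msupp)
  then show ?thesis
    using lifted_cong[OF lifted_mult[OF assms(1) C(1)] assms(3)] by blast
qed

lemma lifted_cancel_left:
  assumes "lifted (mmult I A B)" "lifted A" "B \<in> adm"
  shows "lifted B"
proof -
  obtain C where C: "lifted C" "red (mmult I C A) = mone I"
    using lifted_inverse[OF assms(2)] by blast
  have "red (mmult I C (mmult I A B)) = red (mmult I (mone I) B)"
    unfolding mmult_assoc[symmetric]
    by (rule red_mult_cong) (use assms C in \<open>auto simp: adm_mult lifted_adm mone_adm red_mone\<close>)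
  then have "red B = red (mmult I C (mmult I A B))"
    using assms(3) by (simp add: mone_mult adm_msupp)
  then show ?thesis
    using lifted_cong[OF lifted_mult[OF C(1) assms(1)] assms(3)] by blast
qed

lemma lifted_elem_a: "i < h \<Longrightarrow> y \<in> carrier (GL_grp (l i)) \<Longrightarrow> lifted (elem_a h l i (const_mat y))"
  by (rule lifted_of_mem[OF elem_a_in])

lemma lifted_mswap:
  assumes "x \<in> I" "y \<in> I" "fst x = fst y"
  shows "lifted (mswap I x y)"
proof -
  obtain i r s where xy: "x = (i, r)" "y = (i, s)"
    using assms(3) by (metis prod.collapse)
  then have *: "i < h" "r < l i" "s < l i"
    using assms by (auto simp: blk_idx_def)
  show ?thesis
    unfolding xy elem_a_mswap[OF *, symmetric] using * by (intro lifted_elem_a mswap_GL)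
qed

lemma fst_transpose: "fst x = fst y \<Longrightarrow> fst (Transposition.transpose x y u) = fst u"
  by (simp add: Transposition.transpose_def)

text \<open>Conjugation by a constant swap inside a block; block indices do not change, so the gap
  and admissibility persist.\<close>

lemma lifted_swap_transv:
  assumes "x \<in> I" "y \<in> I" "fst x = fst y" "u \<in> I" "v \<in> I" "u \<noteq> v" "lifted (transv I u v f)"
  shows "lifted (transv I (Transposition.transpose x y u) (Transposition.transpose x y v) f)"
proof (rule lifted_cancel_right)
  show "lifted (mmult I (transv I (Transposition.transpose x y u) (Transposition.transpose x y v) f) (mswap I x y))"
    unfolding mswap_transv[OF finite_I assms(1,2,4,5,6), symmetric]
    by (intro lifted_mult lifted_mswap assms)
  have "tpow (gap u v) dvd f"
    using lifted_adm[OF assms(7)] assms by (simp add: adm_transv_iff)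
  then show "transv I (Transposition.transpose x y u) (Transposition.transpose x y v) f \<in> adm"
    using assms by (subst adm_transv_iff) (auto simp: transpose_mem[OF finite_I] fst_transpose dest: injD[OF inj_transpose])
qed (rule lifted_mswap[OF assms(1-3)])

subsection \<open>Dilations\<close>

lemma lifted_mdil_cong:
  assumes "x \<in> I" "lifted (mdil I x d)" "tpow (lam (fst x)) dvd e - d"
  shows "lifted (mdil I x e)"
proof (rule lifted_cong[OF assms(2)])
  show "red (mdil I x e) = red (mdil I x d)"
    unfolding red_eq_iff using assms(3) by (auto simp: mdil_def mcol_def)
qed (simp add: adm_mdil assms)

lemma lifted_mdil_1: "lifted (mdil I x 1)"
  by (simp add: mdil_1 lifted_mone)

lemma lifted_mdil_mult: "x \<in> I \<Longrightarrow> lifted (mdil I x d) \<Longrightarrow> lifted (mdil I x e) \<Longrightarrow> lifted (mdil I x (d * e))"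
  using lifted_mult[of "mdil I x d" "mdil I x e"] by (simp add: mdil_mdil)

text \<open>For \<open>k \<ge> lam i\<close> the dilation reduces to the identity, which frees the
  later induction from an upper bound on \<open>k\<close>.\<close>

lemma lifted_mdil_generator:
  assumes "i < h" "1 \<le> k" "c \<in> W"
  shows "lifted (mdil I (i, 0) (1 + monom c k))"
proof (cases "k < lam i")
  case True
  then show ?thesis
    using lifted_of_mem[OF elem_b_in] assms by (simp add: elem_b_mdil)
next
  case False
  then have "tpow (lam i) dvd monom c k"
    by (simp add: tpow_dvd_iff)
  moreover have "(i, 0) \<in> I"
    using assms l_pos by (simp add: blk_idx_def)
  ultimately show ?thesis
    by (intro lifted_mdil_cong[OF _ lifted_mdil_1]) simp_all
qed

text \<open>The coefficients \<open>c\<close> attainable at level \<open>k\<close> form an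
  additively closed set containing \<open>W\<close>, because \<open>(1 + b t^k)(1 + c t^k)\<close>
  agrees with \<open>1 + (b + c) t^k\<close> modulo \<open>t^(k+1)\<close>.\<close>

lemma lifted_mdil_level:
  assumes "i < h" "1 \<le> k"
  obtains d where "lifted (mdil I (i, 0) d)" "tpow (Suc k) dvd d - (1 + monom c k)"
proof -
  have i0: "(i, 0) \<in> I"
    using assms l_pos by (auto simp: blk_idx_def)
  define S where "S = {c. \<exists>d. lifted (mdil I (i, 0) d) \<and> tpow (Suc k) dvd d - (1 + monom c k)}"
  have "S = UNIV"
  proof (rule W_spans)
    show "0 \<in> S"
      unfolding S_def using lifted_mdil_1 by (auto intro!: exI[of _ 1])
    show "W \<subseteq> S"
      unfolding S_def using lifted_mdil_generator[OF assms] by (auto intro!: exI[of _ "1 + monom _ k"])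
    fix b c assume "b \<in> S" "c \<in> S"
    then obtain d e where d: "lifted (mdil I (i, 0) d)" "tpow (Suc k) dvd d - (1 + monom b k)"
      and e: "lifted (mdil I (i, 0) e)" "tpow (Suc k) dvd e - (1 + monom c k)"
      unfolding S_def by blast
    \<comment> \<open>From \<open>k \<ge> 1\<close> follows \<open>2 k \<ge> k + 1\<close>.\<close>
    have "tpow (Suc k) dvd (monom b k * monom c k :: 'a poly)"
      using assms(2) by (auto simp: mult_monom tpow_dvd_iff)
    moreover have "d * e - (1 + monom (b + c) k) = (d - (1 + monom b k)) * e
        + (1 + monom b k) * (e - (1 + monom c k)) + monom b k * monom c k"
      by (simp add: algebra_simps flip: add_monom)
    ultimately have "tpow (Suc k) dvd d * e - (1 + monom (b + c) k)"
      using d e by simp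
    then show "b + c \<in> S"
      unfolding S_def using lifted_mdil_mult[OF i0 d(1) e(1)] by blast
  qed
  then show ?thesis
    using that unfolding S_def by blast
qed

text \<open>Induction on \<open>lam i - k\<close>: dividing \<open>d\<close> by a lifted
  \<open>e\<close> that agrees with it modulo \<open>t^(k+1)\<close> leaves a quotient one level
  higher. Once \<open>k \<ge> lam i\<close>, the dilation reduces to the identity.\<close>

lemma lifted_mdil_principal:
  assumes "i < h" "1 \<le> k" "tpow k dvd d - 1"
  shows "lifted (mdil I (i, 0) d)"
  using assms(2,3)
proof (induction "lam i - k" arbitrary: k d)
  case 0
  then have "tpow (lam i) dvd d - 1"
    by (intro dvd_trans[OF tpow_dvd_tpow 0(3)]) simp
  moreover have "(i, 0) \<in> I"
    using assms l_pos by (simp add: blk_idx_def)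
  ultimately show ?case
    by (intro lifted_mdil_cong[OF _ lifted_mdil_1]) simp_all
next
  case (Suc n)
  have i0: "(i, 0) \<in> I"
    using assms l_pos by (auto simp: blk_idx_def)
  obtain e where e: "lifted (mdil I (i, 0) e)" "tpow (Suc k) dvd e - (1 + monom (coeff d k) k)"
    using lifted_mdil_level[OF assms(1) Suc.prems(1)] by blast
  have "coeff e 0 = 1"
    using e(2) Suc.prems(1) by (auto simp: tpow_dvd_iff dest!: spec[of _ 0])
  \<comment> \<open>The exponent covers two uses of the inverse: modulo \<open>t^(k+1)\<close> for
    the level of \<open>w * d\<close>, and modulo \<open>t^(lam i)\<close> to recover
    \<open>d\<close> from \<open>e * (w * d)\<close>.\<close>
  then obtain w where w: "tpow (Suc k + lam i) dvd e * w - 1"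
    using inverse_mod_tpow[of e] by auto
  have "tpow (Suc k) dvd d - (1 + monom (coeff d k) k)"
    using Suc.prems by (auto simp: tpow_dvd_iff less_Suc_eq)
  then have de: "tpow (Suc k) dvd d - e"
    using dvd_diff[OF _ e(2)] by fastforce
  have "tpow (Suc k) dvd e * w - 1"
    using w by (rule dvd_trans[rotated]) (simp add: tpow_dvd_tpow)
  with de have "tpow (Suc k) dvd (d - e) * w + (e * w - 1)"
    by simp
  then have "tpow (Suc k) dvd w * d - 1"
    by (simp add: algebra_simps)
  then have "lifted (mdil I (i, 0) (w * d))"
    using Suc.hyps(2) by (intro Suc.hyps(1)[of "Suc k"]) auto
  then have "lifted (mdil I (i, 0) (e * (w * d)))"
    by (rule lifted_mdil_mult[OF i0 e(1)])
  moreover have "tpow (lam i) dvd e * w - 1"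
    using w by (rule dvd_trans[rotated]) (simp add: tpow_dvd_tpow)
  then have "tpow (lam i) dvd (e * w - 1) * (- d)"
    by (rule dvd_mult2)
  then have "tpow (lam i) dvd d - e * (w * d)"
    by (simp add: algebra_simps)
  ultimately show ?case
    using lifted_mdil_cong[OF i0, of "e * (w * d)" d] by simp
qed

text \<open>A unit is its constant term, supplied by the general linear group, times a unit
  congruent to 1. A swap then moves the dilation from position 0 to any position of the
  block.\<close>

lemma lifted_mdil:
  assumes "x \<in> I" "coeff d 0 \<noteq> 0"
  shows "lifted (mdil I x d)"
proof -
  obtain i r where x: "x = (i, r)" by force
  then have ir: "i < h" "r < l i" "0 < l i"
    using assms by (auto simp: blk_idx_def)
  then have i0: "(i, 0) \<in> I"
    by (simp add: blk_idx_def)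
  define c where "c = coeff d 0"
  have "tpow 1 dvd smult (1 / c) d - 1"
    using assms by (simp add: tpow_dvd_iff c_def)
  then have "lifted (mdil I (i, 0) (smult (1 / c) d))"
    by (intro lifted_mdil_principal[of i 1]) (use ir in auto)
  moreover have "lifted (mdil I (i, 0) [:c:])"
    unfolding elem_a_mdil[OF ir(1,3), symmetric] using assms(2)
    by (intro lifted_elem_a mdil_GL ir) (simp add: c_def)
  ultimately have "lifted (mdil I (i, 0) ([:c:] * smult (1 / c) d))"
    using lifted_mdil_mult[OF i0] by blast
  then have *: "lifted (mdil I (i, 0) d)"
    using assms by (simp add: c_def)
  let ?P = "mswap I (i, 0) x"
  have P: "lifted ?P"
    using x assms i0 by (intro lifted_mswap) auto
  have eq: "mmult I ?P (mdil I (i, 0) d) = mmult I (mdil I x d) ?P"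
    using mswap_mdil[OF finite_I i0 assms(1) i0, of d] by simp
  show ?thesis
    by (rule lifted_cancel_right[OF lifted_mult[OF P *, unfolded eq] P adm_mdil[OF assms(1)]])
qed

subsection \<open>Transvections\<close>

lemma lifted_transv_add:
  assumes "x \<in> I" "y \<in> I" "x \<noteq> y" "lifted (transv I x y f)" "lifted (transv I x y g)"
  shows "lifted (transv I x y (f + g))"
  using lifted_mult[OF assms(4,5)] assms by (simp add: transv_add)

lemma lifted_transv_unit_mult:
  assumes "x \<in> I" "y \<in> I" "x \<noteq> y" "lifted (transv I x y f)" "coeff d 0 \<noteq> 0"
  shows "lifted (transv I x y (d * f))"
proof (rule lifted_cancel_right)
  show "lifted (mmult I (transv I x y (d * f)) (mdil I x d))"
    unfolding mdil_transv[OF finite_I assms(1-3), symmetric]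
    by (intro lifted_mult lifted_mdil assms)
  show "transv I x y (d * f) \<in> adm"
    using lifted_adm[OF assms(4)] assms by (simp add: adm_transv_iff)
qed (rule lifted_mdil[OF assms(1,5)])

text \<open>Every polynomial is a unit modulo \<open>t\<close> or the difference of two such units.\<close>

lemma lifted_transv_mult:
  assumes "x \<in> I" "y \<in> I" "x \<noteq> y" "lifted (transv I x y f)"
  shows "lifted (transv I x y (g * f))"
proof (cases "coeff g 0 = 0")
  case True
  then have "lifted (transv I x y ((1 + g) * f))" "lifted (transv I x y ((- 1) * f))"
    by (intro lifted_transv_unit_mult assms; simp)+
  then have "lifted (transv I x y ((1 + g) * f + (- 1) * f))"
    by (rule lifted_transv_add[OF assms(1-3)])
  then show ?thesis
    by (simp add: algebra_simps)
qed (use assms lifted_transv_unit_mult in blast)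

lemma lifted_transv_commutator:
  assumes "x \<in> I" "y \<in> I" "z \<in> I" "x \<noteq> y" "y \<noteq> z" "x \<noteq> z"
    and fg: "lifted (transv I x y f)" "lifted (transv I y z g)"
  shows "lifted (transv I x z (f * g))"
proof (rule lifted_cancel_right)
  show "lifted (mmult I (transv I x z (f * g)) (mmult I (transv I y z g) (transv I x y f)))"
    unfolding transv_commutator[OF finite_I assms(1-6), symmetric] by (intro lifted_mult fg)
  show "transv I x z (f * g) \<in> adm"
    using fg[THEN lifted_adm] assms by (auto simp: adm_transv_iff intro: tpow_gap_mult)
qed (intro lifted_mult fg)

lemma lifted_transv_same_block:
  assumes "(i, r) \<in> I" "(i, s) \<in> I" "r \<noteq> s"
  shows "lifted (transv I (i, r) (i, s) 1)"
proof -
  have *: "i < h" "r < l i" "s < l i"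
    using assms by (auto simp: blk_idx_def)
  have "lifted (elem_a h l i (const_mat (transv {..<l i} r s 1)))"
    by (intro lifted_elem_a transv_GL * assms)
  then show ?thesis
    by (simp add: elem_a_transv[OF * assms(3)] one_pCons)
qed

text \<open>One swap in each block; as the blocks differ, each swap moves only one of the two
  indices.\<close>

lemma lifted_transv_between_blocks:
  assumes "i \<noteq> j" "(i, r) \<in> I" "(j, s) \<in> I" "(i, r') \<in> I" "(j, s') \<in> I" "lifted (transv I (i, r) (j, s) f)"
  shows "lifted (transv I (i, r') (j, s') f)"
  using lifted_swap_transv[of "(j, s)" "(j, s')" "(i, r')" "(j, s)" f]
    lifted_swap_transv[of "(i, r)" "(i, r')" "(i, r)" "(j, s)" f] assms
  by (auto simp: Transposition.transpose_def)

text \<open>Commutators chain neighbouring blocks together, and the exponents telescope because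
  \<open>lam\<close> increases.\<close>

lemma lifted_transv_up:
  assumes "i < j" "(i, r) \<in> I" "(j, s) \<in> I"
  shows "lifted (transv I (i, r) (j, s) (tpow (lam j - lam i)))"
  using assms
proof (induction j arbitrary: s)
  case (Suc j)
  have j: "j < h" "Suc j < h" "(j, l j - 1) \<in> I" "(Suc j, 0) \<in> I" "(j, 0) \<in> I"
    using Suc.prems l_pos[of j] l_pos[of "Suc j"] by (auto simp: blk_idx_def)
  have adj: "lifted (transv I (j, r) (Suc j, s) (tpow (lam (Suc j) - lam j)))" if "(j, r) \<in> I" for r
  proof (rule lifted_transv_between_blocks[OF _ j(3,4)])
    show "lifted (transv I (j, l j - 1) (Suc j, 0) (tpow (lam (Suc j) - lam j)))"
      using lifted_of_mem[OF elem_cplus_in[of j]] elem_cplus_transv[of j, where 'a='a] j by simp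
  qed (use that Suc.prems in auto)
  show ?case
  proof (cases "i = j")
    case False
    then have "i < j" using Suc.prems by simp
    then have "lifted (transv I (i, r) (Suc j, s) (tpow (lam j - lam i) * tpow (lam (Suc j) - lam j)))"
      using Suc j adj by (intro lifted_transv_commutator[of _ "(j, 0)"]) auto
    moreover have "(lam j - lam i) + (lam (Suc j) - lam j) = lam (Suc j) - lam i"
      using lam_less[of i j] lam_less[of j "Suc j"] \<open>i < j\<close> j by simp
    ultimately show ?thesis
      by (simp flip: tpow_add)
  qed (use adj Suc.prems in auto)
qed simp

text \<open>Same chaining with the elements \<open>elem_cminus\<close>; downwards no power of
  \<open>t\<close> is imposed, so all factors are 1.\<close>

lemma lifted_transv_down:
  assumes "j < i" "(i, r) \<in> I" "(j, s) \<in> I"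
  shows "lifted (transv I (i, r) (j, s) 1)"
  using assms
proof (induction i arbitrary: r)
  case (Suc i)
  have i: "i < h" "Suc i < h" "(i, l i - 1) \<in> I" "(Suc i, 0) \<in> I" "(i, 0) \<in> I"
    using Suc.prems l_pos[of i] l_pos[of "Suc i"] by (auto simp: blk_idx_def)
  have adj: "lifted (transv I (Suc i, r) (i, s) 1)" if "(i, s) \<in> I" for s
  proof (rule lifted_transv_between_blocks[OF _ i(4,3)])
    show "lifted (transv I (Suc i, 0) (i, l i - 1) 1)"
      using lifted_of_mem[OF elem_cminus_in[of i]] elem_cminus_transv[of i, where 'a='a] i by simp
  qed (use that Suc.prems in auto)
  show ?case
  proof (cases "j = i")
    case False
    then have "lifted (transv I (Suc i, r) (j, s) (1 * 1))"
      using Suc i adj by (intro lifted_transv_commutator[of _ "(i, 0)"]) auto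
    then show ?thesis by simp
  qed (use adj Suc.prems in auto)
qed simp

lemma lifted_transv:
  assumes "x \<in> I" "y \<in> I" "x \<noteq> y" "tpow (gap x y) dvd f"
  shows "lifted (transv I x y f)"
proof -
  obtain i r j s where xy: "x = (i, r)" "y = (j, s)" by force
  consider "i < j" | "i = j" "r \<noteq> s" | "j < i"
    using assms xy by fastforce
  then have "lifted (transv I x y (tpow (gap x y)))"
  proof cases
    case 3
    \<comment> \<open>Truncated subtraction: below the block diagonal the generator of the ideal is
      \<open>tpow 0 = 1\<close>.\<close>
    then have "lam j - lam i = 0"
      using lam_less[of j i] I_fst[OF assms(1)] xy by simp
    then show ?thesis
      using 3 lifted_transv_down[of j i r s] assms xy by simp
  qed (use assms xy lifted_transv_up[of i j r s] lifted_transv_same_block[of i r s] in auto)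
  moreover obtain g where "f = g * tpow (gap x y)"
    using assms(4) by (metis dvdE mult.commute)
  ultimately show ?thesis
    using lifted_transv_mult[OF assms(1-3)] by blast
qed

text \<open>Starting from the dilation by the pivot, transvections fill in the other entries of the
  column one at a time.\<close>

lemma lifted_mcol:
  assumes x: "x \<in> I" and v: "coeff (v x) 0 \<noteq> 0" "\<And>u. u \<in> I \<Longrightarrow> tpow (gap u x) dvd v u"
  shows "lifted (mcol I x v)"
proof -
  \<comment> \<open>\<open>F\<close> collects the rows filled in so far; the remaining off-pivot
    entries are kept at 0, as \<open>mcol_transv\<close> demands.\<close>
  have "lifted (mcol I x (\<lambda>u. if u \<in> F \<or> u = x then v u else 0))" if "finite F" "F \<subseteq> I - {x}" for F
    using that
  proof (induction F)
    case empty
    have "(\<lambda>u. if u \<in> {} \<or> u = x then v u else 0) = (\<lambda>u. 0)(x := v x)"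
      by auto
    then show ?case
      using lifted_mdil[OF x v(1)] unfolding mdil_def by simp
  next
    case (insert y F)
    let ?v = "\<lambda>u. if u \<in> F \<or> u = x then v u else 0"
    have "(\<lambda>u. if u \<in> insert y F \<or> u = x then v u else 0) = ?v(y := v y)"
      by auto
    moreover have "mcol I x (?v(y := v y)) = mmult I (mcol I x ?v) (transv I y x (v y))"
      using insert x by (intro mcol_transv[symmetric]) auto
    moreover have "lifted (transv I y x (v y))"
      using insert x v by (intro lifted_transv) auto
    ultimately show ?case
      using insert lifted_mult by simp
  qed
  from this[of "I - {x}"] have "lifted (mcol I x (\<lambda>u. if u \<in> I - {x} \<or> u = x then v u else 0))"
    by simp
  moreover have "mcol I x (\<lambda>u. if u \<in> I - {x} \<or> u = x then v u else 0) = mcol I x v"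
    unfolding mcol_def by (intro ext) simp
  ultimately show ?thesis by simp
qed

section \<open>Gaussian elimination\<close>

text \<open>The invariant of the elimination: it makes every pivot a unit modulo \<open>t\<close>
  and survives the clearing of a column.\<close>

definition blockwise_unipotent :: "(nat \<times> nat \<Rightarrow> nat \<times> nat \<Rightarrow> 'a poly) \<Rightarrow> bool" where
  "blockwise_unipotent A \<longleftrightarrow>
    (\<forall>u\<in>I. \<forall>z\<in>I. fst u = fst z \<longrightarrow> coeff (A u z) 0 = (if u = z then 1 else 0))"

text \<open>Leaving a block and coming back must go up once, and going up costs a positive power of
  \<open>t\<close>.\<close>

lemma adm_off_diagonal_coeff_0:
  assumes "A \<in> adm" "B \<in> adm" "x \<in> I" "u \<in> I" "z \<in> I" "fst u = fst z" "fst x \<noteq> fst u"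
  shows "coeff (A u x * B x z) 0 = 0"
proof (cases "fst u < fst x")
  case True
  then have "0 < gap u x"
    using lam_less I_fst[OF assms(3)] by simp
  then have "coeff (A u x) 0 = 0"
    using admD[OF assms(1,4,3)] by (rule coeff_0_tpow_dvd)
  then show ?thesis by (simp add: coeff_mult_0)
next
  case False
  then have "0 < gap x z"
    using lam_less[of "fst x" "fst z"] I_fst[OF assms(5)] assms(6,7) by simp
  then have "coeff (B x z) 0 = 0"
    using admD[OF assms(2,3,5)] by (rule coeff_0_tpow_dvd)
  then show ?thesis by (simp add: coeff_mult_0)
qed

text \<open>The columns outside \<open>K\<close> are already those of the identity. Splitting off the
  column of a pivot \<open>x\<close> as a left factor clears that column and keeps the cleared ones.\<close>

lemma lifted_if_cleared_outside:
  assumes "finite K" "K \<subseteq> I" "A \<in> adm" "blockwise_unipotent A"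
    and "\<And>u z. u \<in> I \<Longrightarrow> z \<in> I - K \<Longrightarrow> A u z = (if u = z then 1 else 0)"
  shows "lifted A"
  using assms
proof (induction K arbitrary: A)
  case empty
  then have "A = mone I"
    by (intro msupp_eqI[of _ I]) (simp_all add: adm_msupp, simp_all add: mone_def)
  then show ?case
    using lifted_mone by simp
next
  case (insert x K)
  note A = insert.prems(2) and uni = insert.prems(3)[unfolded blockwise_unipotent_def, rule_format]
    and clear = insert.prems(4)
  have x: "x \<in> I" using insert.prems by simp
  have Axx: "coeff (A x x) 0 = 1"
    using uni[OF x x] by simp
  \<comment> \<open>An exponent at least as large as every \<open>lam i\<close>, so that one
    \<open>w\<close> inverts the pivot in all block columns.\<close>
  define N where "N = (\<Sum>i<h. lam i)"
  have N: "lam (fst z) \<le> N" if "z \<in> I" for z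
    unfolding N_def using I_fst[OF that] by (intro member_le_sum) auto
  obtain w where w: "tpow N dvd A x x * w - 1"
    using inverse_mod_tpow[of "A x x"] Axx by auto
  have "0 < N"
    using N[OF x] I_lam_pos[OF x] by simp
  then have "coeff (A x x * w - 1) 0 = 0"
    using w coeff_0_tpow_dvd by blast
  then have w0: "coeff w 0 = 1"
    using Axx by (simp add: coeff_mult_0)
  \<comment> \<open>The solution of \<open>A = mcol I x (A _ x) B\<close> modulo the column moduli:
    row \<open>x\<close> is divided by the pivot, and the other rows are corrected by their multiple
    of it. Column \<open>x\<close>, now outside \<open>K\<close>, becomes a unit vector.\<close>
  define B where "B = (\<lambda>u z. if u \<in> I \<and> z \<in> I then
      if z \<in> K then (if u = x then w * A x z else A u z - A u x * (w * A x z))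
      else (if u = z then 1 else 0) else 0)"
  have row: "tpow (gap x z) dvd w * A x z" if "z \<in> I" for z
    using admD[OF A x that] by simp
  have B: "B \<in> adm"
    unfolding adm_def msupp_def
  proof (intro CollectI conjI ballI)
    fix u z assume uz: "u \<in> I" "z \<in> I"
    have "tpow (gap u z) dvd A u z - A u x * (w * A x z)"
      by (rule dvd_diff[OF admD[OF A uz] tpow_gap_mult[OF admD[OF A uz(1) x] row[OF uz(2)]]])
    then show "tpow (gap u z) dvd B u z"
      using uz row by (auto simp: B_def)
  qed (auto simp: B_def)
  have "blockwise_unipotent B"
    unfolding blockwise_unipotent_def
  proof (intro ballI impI)
    fix u z assume uz: "u \<in> I" "z \<in> I" "fst u = fst z"
    \<comment> \<open>The correction term vanishes modulo \<open>t\<close>: inside the block of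
      \<open>x\<close> by the invariant, elsewhere by passing through another block.\<close>
    have "coeff (A u x * A x z) 0 = 0" if "u \<noteq> x"
    proof (cases "fst x = fst u")
      case True
      then show ?thesis
        using uni[OF uz(1) x] that by (simp add: coeff_mult_0)
    qed (use adm_off_diagonal_coeff_0[OF A A x uz] in simp)
    then show "coeff (B u z) 0 = (if u = z then 1 else 0)"
      using uz uni[OF uz] x w0 by (auto simp: B_def coeff_mult_0)
  qed
  then have "lifted B"
    using insert.prems(1) B by (intro insert.IH) (auto simp: B_def)
  moreover have "lifted (mcol I x (\<lambda>u. A u x))"
    using x A Axx by (intro lifted_mcol) (auto simp: admD)
  ultimately have "lifted (mmult I (mcol I x (\<lambda>u. A u x)) B)"
    by (simp add: lifted_mult)
  moreover have "red A = red (mmult I (mcol I x (\<lambda>u. A u x)) B)"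
    unfolding red_eq_iff
  proof (intro ballI)
    fix u z assume uz: "u \<in> I" "z \<in> I"
    \<comment> \<open>The factorization is exact except in row \<open>x\<close>, where
      \<open>A x x * w\<close> is 1 only modulo \<open>tpow N\<close>.\<close>
    have "tpow (lam (fst z)) dvd (A x x * w - 1) * (- A x z)"
      using w tpow_dvd_tpow[OF N[OF uz(2)]] by (meson dvd_mult2 dvd_trans)
    then have "tpow (lam (fst z)) dvd A x z - A x x * (w * A x z)"
      by (simp add: algebra_simps)
    moreover consider "z \<in> K" | "z = x" "z \<notin> K" | "z \<notin> insert x K" by blast
    ultimately show "tpow (lam (fst z)) dvd A u z - mmult I (mcol I x (\<lambda>u. A u x)) B u z"
      using uz x insert.hyps clear[of _ z]
      by cases (auto simp: mcol_mult B_def)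
  qed
  ultimately show ?case
    using lifted_cong A by blast
qed

lemma lifted_blockwise_unipotent: "A \<in> adm \<Longrightarrow> blockwise_unipotent A \<Longrightarrow> lifted A"
  by (rule lifted_if_cleared_outside[of I]) auto

section \<open>Constant block diagonal parts\<close>

definition block_const :: "(nat \<times> nat \<Rightarrow> nat \<times> nat \<Rightarrow> 'a poly) \<Rightarrow> nat \<Rightarrow> nat \<Rightarrow> nat \<Rightarrow> 'a" where
  "block_const A i = (\<lambda>r s. if r < l i \<and> s < l i then coeff (A (i, r) (i, s)) 0 else 0)"

text \<open>The parameter \<open>n\<close> lets the block diagonal matrix be assembled from one
  factor \<open>elem_a\<close> per block.\<close>

definition const_part :: "nat \<Rightarrow> (nat \<times> nat \<Rightarrow> nat \<times> nat \<Rightarrow> 'a poly) \<Rightarrow> nat \<times> nat \<Rightarrow> nat \<times> nat \<Rightarrow> 'a poly" where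
  "const_part n A = (\<lambda>u z. if u \<in> I \<and> z \<in> I then
     if fst u = fst z \<and> fst u < n then [:coeff (A u z) 0:] else if u = z then 1 else 0 else 0)"

lemma sum_over_block:
  assumes "A \<in> adm" "B \<in> adm" "u \<in> I" "z \<in> I" "fst u = fst z"
  shows "coeff (mmult I A B u z) 0
    = (\<Sum>r<l (fst u). coeff (A u (fst u, r)) 0 * coeff (B (fst u, r) z) 0)"
proof -
  have "coeff (mmult I A B u z) 0 = (\<Sum>x\<in>I. coeff (A u x * B x z) 0)"
    using assms by (simp add: mmult_def coeff_sum)
  also have "\<dots> = (\<Sum>x\<in>I. if fst x = fst u then coeff (A u x) 0 * coeff (B x z) 0 else 0)"
    using adm_off_diagonal_coeff_0[OF assms(1,2) _ assms(3-5)]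
    by (intro sum.cong) (auto simp: coeff_mult_0)
  finally show ?thesis
    by (simp add: sum_blk_row[OF I_fst[OF assms(3)]])
qed

lemma coeff_0_of_red_eq:
  assumes "red A = red B" "u \<in> I" "z \<in> I"
  shows "coeff (A u z) 0 = coeff (B u z) 0"
proof -
  have "tpow (lam (fst z)) dvd A u z - B u z"
    using assms red_eq_iff by blast
  then have "coeff (A u z - B u z) 0 = 0"
    using coeff_0_tpow_dvd I_lam_pos[OF assms(3)] by blast
  then show ?thesis by simp
qed

text \<open>Taking constant terms of a diagonal block is multiplicative, since detours through other
  blocks vanish modulo \<open>t\<close>.\<close>

lemma block_const_mult:
  assumes "A \<in> adm" "B \<in> adm" "red (mmult I A B) = mone I" "i < h"
  shows "mmult {..<l i} (block_const A i) (block_const B i) = mone {..<l i}"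
proof (rule msupp_eqI[of _ "{..<l i}"])
  fix r s assume "r \<in> {..<l i}" "s \<in> {..<l i}"
  then have rs: "(i, r) \<in> I" "(i, s) \<in> I" "r < l i" "s < l i"
    using assms(4) by (auto simp: blk_idx_def)
  have "coeff (mmult I A B (i, r) (i, s)) 0 = coeff (mone I (i, r) (i, s) :: 'a poly) 0"
    by (rule coeff_0_of_red_eq) (use assms rs in \<open>simp_all add: red_mone\<close>)
  then show "mmult {..<l i} (block_const A i) (block_const B i) r s = mone {..<l i} r s"
    using sum_over_block[OF assms(1,2) rs(1,2)] rs
    by (auto simp: mmult_def[of "{..<l i}"] block_const_def mone_def)
qed auto

lemma block_const_GL:
  assumes "A \<in> adm" "B \<in> adm" "red (mmult I A B) = mone I" "red (mmult I B A) = mone I" "i < h"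
  shows "block_const A i \<in> carrier (GL_grp (l i))"
proof -
  have "block_const C i \<in> msupp {..<l i}" for C
    by (auto simp: msupp_def block_const_def)
  then show ?thesis
    unfolding GL_grp_carrier_iff using block_const_mult[OF assms(1,2,3,5)] block_const_mult[OF assms(2,1,4,5)]
    by blast
qed

text \<open>The right factor changes only the columns of block \<open>n\<close>, where the left
  factor is still the identity.\<close>

lemma const_part_Suc:
  assumes "n < h"
  shows "const_part (Suc n) A
    = mmult I (const_part n A) (elem_a h l n (const_mat (block_const A n)))" (is "_ = mmult I ?C ?E")
proof (rule msupp_eqI[of _ I])
  show "const_part (Suc n) A \<in> msupp I"
    by (auto simp: msupp_def const_part_def)
  fix u z assume uz: "u \<in> I" "z \<in> I"
  have sum: "mmult I ?C ?E u z = (\<Sum>x\<in>I. ?C u x * ?E x z)"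
    using uz by (simp add: mmult_def)
  show "const_part (Suc n) A u z = mmult I ?C ?E u z"
  proof (cases "fst z = n")
    case True
    have "mmult I ?C ?E u z = (\<Sum>x\<in>I. if x = u then ?E u z else 0)"
      unfolding sum using uz True by (intro sum.cong) (auto simp: const_part_def elem_a_def)
    also have "\<dots> = ?E u z"
      using uz by simp
    also have "\<dots> = const_part (Suc n) A u z"
    proof (cases "fst u = n")
      case u: True
      then have "block_const A n (snd u) (snd z) = coeff (A u z) 0"
        using uz True by (auto simp: block_const_def blk_idx_def)
      then show ?thesis
        using uz True u by (simp add: const_part_def elem_a_def const_mat_def)
    next
      case u: False
      then have "u \<noteq> z" using True by blast
      then show ?thesis
        using uz True u by (simp add: const_part_def elem_a_def)
    qed
    finally show ?thesis by simp
  next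
    case False
    have "mmult I ?C ?E u z = (\<Sum>x\<in>I. if x = z then ?C u z else 0)"
      unfolding sum using uz False by (intro sum.cong) (auto simp: elem_a_def)
    also have "\<dots> = ?C u z"
      using uz by simp
    also have "\<dots> = const_part (Suc n) A u z"
      using uz False by (auto simp: const_part_def less_Suc_eq)
    finally show ?thesis by simp
  qed
qed simp

lemma lifted_const_part:
  assumes "\<And>i. i < h \<Longrightarrow> block_const A i \<in> carrier (GL_grp (l i))" "n \<le> h"
  shows "lifted (const_part n A)"
  using assms(2)
proof (induction n)
  case 0
  have "const_part 0 A = mone I"
    by (rule msupp_eqI[of _ I]) (auto simp: const_part_def msupp_def mone_def)
  then show ?case
    using lifted_mone by simp
next
  case (Suc n)
  then show ?case
    using assms(1) by (simp add: const_part_Suc lifted_mult lifted_elem_a)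
qed

lemma coeff_const_part:
  assumes "u \<in> I" "z \<in> I" "fst u = fst z"
  shows "coeff (const_part h A u z) 0 = coeff (A u z) 0"
  using assms I_fst[OF assms(1)] by (simp add: const_part_def)

text \<open>The constant block diagonal part of the inverse \<open>B\<close> lies in
  \<open>G\<close> and makes the diagonal blocks of \<open>A\<close> congruent to the identity
  modulo \<open>t\<close>; elimination handles the product.\<close>

theorem units_subset: "carrier (lam_units h lam l) \<subseteq> G"
proof
  fix A :: "nat \<times> nat \<Rightarrow> nat \<times> nat \<Rightarrow> 'a poly"
  assume "A \<in> carrier (lam_units h lam l)"
  then obtain B where AB: "A \<in> lam_carrier h lam l" "B \<in> adm"
    "red (mmult I B A) = mone I" "red (mmult I A B) = mone I"
    unfolding lam_units_carrier_iff using lam_carrier_adm by blast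
  note A = lam_carrier_adm[OF AB(1)]
  have C: "lifted (const_part h B)"
    using block_const_GL[OF AB(2) A AB(3,4)] by (intro lifted_const_part) auto
  note Ca = lifted_adm[OF C]
  have "blockwise_unipotent (mmult I (const_part h B) A)"
    unfolding blockwise_unipotent_def
  proof (intro ballI impI)
    fix u z assume uz: "u \<in> I" "z \<in> I" "fst u = fst z"
    have "coeff (mmult I (const_part h B) A u z) 0 = coeff (mmult I B A u z) 0"
      unfolding sum_over_block[OF Ca A uz] sum_over_block[OF AB(2) A uz]
      using uz I_fst[OF uz(1)] by (intro sum.cong) (auto simp: coeff_const_part blk_idx_def)
    also have "\<dots> = coeff (mone I u z :: 'a poly) 0"
      by (rule coeff_0_of_red_eq) (use AB uz in \<open>simp_all add: red_mone\<close>)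
    finally show "coeff (mmult I (const_part h B) A u z) 0 = (if u = z then 1 else 0)"
      using uz by (simp add: mone_def)
  qed
  then have "lifted (mmult I (const_part h B) A)"
    by (intro lifted_blockwise_unipotent adm_mult Ca A)
  then have "lifted A"
    by (rule lifted_cancel_left[OF _ C A])
  then show "A \<in> G"
    using red_id[OF AB(1)] by (simp add: lifted_def)
qed

end

section \<open>The generating set\<close>

lemma (in lam_blocks) elem_a_in_units:
  assumes "i < h" "y \<in> carrier (GL_grp (l i))"
  shows "elem_a h l i (const_mat y) \<in> carrier (lam_units h lam l)"
proof -
  obtain z where z: "mmult {..<l i} z y = mone {..<l i}" "mmult {..<l i} y z = mone {..<l i}"
    using assms(2) unfolding GL_grp_carrier_iff by blast
  then have "red (elem_a h l i (const_mat y)) \<in> carrier (lam_units h lam l)"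
    by (intro red_in_units[of _ "elem_a h l i (const_mat z)"])
      (simp_all add: adm_elem_a elem_a_mult[OF assms(1)] elem_a_mone red_mone)
  then show ?thesis
    by (simp add: red_elem_a)
qed

text \<open>The block embedding is a group homomorphism, so it maps the subgroup generated by
  \<open>Y\<close> onto the one generated by the image of \<open>Y\<close>.\<close>

lemma (in lam_blocks) elem_a_in_generate:
  assumes i: "i < h" and Y: "Y \<subseteq> carrier (GL_grp (l i))"
    and y: "y \<in> generate (GL_grp (l i)) Y"
  shows "elem_a h l i (const_mat y) \<in> generate (lam_units h lam l) ((\<lambda>y. elem_a h l i (const_mat y)) ` Y)"
proof -
  interpret hom: group_hom "GL_grp (l i)" "lam_units h lam l" "\<lambda>y. elem_a h l i (const_mat y)"
    by (intro group_hom.intro group_hom_axioms.intro homI group_GL_grp group_lam_units)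
      (auto simp: elem_a_in_units i GL_grp_simps lam_units_simps lam_mult_red elem_a_mult red_elem_a)
  show ?thesis
    using hom.generate_img[OF Y] y by blast
qed

lemma (in lam_blocks) transv_in_units:
  assumes "x \<in> I" "y \<in> I" "x \<noteq> y" "tpow (gap x y) dvd f"
  shows "red (transv I x y f) \<in> carrier (lam_units h lam l)"
  using assms
  by (intro red_in_units[of _ "transv I x y (- f)"]) (simp_all add: adm_transv_iff transv_add transv_0 red_mone)

lemma (in lam_blocks) mdil_in_units:
  assumes "x \<in> I" "coeff d 0 \<noteq> 0"
  shows "red (mdil I x d) \<in> carrier (lam_units h lam l)"
proof -
  obtain w where w: "tpow (lam (fst x)) dvd d * w - 1"
    using inverse_mod_tpow[OF assms(2)] by blast
  then have "red (mdil I x (d * w)) = red (mone I)"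
    unfolding red_eq_iff by (auto simp: mdil_def mcol_def mone_def)
  then show ?thesis
    using assms
    by (intro red_in_units[of _ "mdil I x w"]) (simp_all add: adm_mdil mdil_mdil red_mone mult.commute)
qed

lemma (in lam_blocks) elem_b_in_units:
  assumes "i < h" "1 \<le> k" "k \<le> lam i - 1"
  shows "elem_b h l i (1 + monom c k) \<in> carrier (lam_units h lam l)"
proof -
  have i0: "(i, 0) \<in> I" and k: "k < lam i"
    using assms l_pos lam_pos[OF assms(1)] by (auto simp: blk_idx_def)
  have "red (mdil I (i, 0) (1 + monom c k)) = mdil I (i, 0) (1 + monom c k)"
    using k unfolding red_def mdil_def mcol_def fun_eq_iff
    by (simp add: poly_mod_add_left mod_tpow_one pair_I_lam_pos mod_tpow_monom)
  moreover have "coeff (1 + monom c k) 0 \<noteq> 0"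
    using assms by simp
  ultimately show ?thesis
    using mdil_in_units[OF i0, of "1 + monom c k"] assms by (simp add: elem_b_mdil)
qed

lemma (in lam_blocks) red_transv:
  assumes "y \<in> I" "f mod tpow (lam (fst y)) = f"
  shows "red (transv I x y f) = transv I x y f"
  using assms unfolding red_def transv_def mcol_def fun_eq_iff
  by (auto simp: mod_tpow_one pair_I_lam_pos)

lemma (in lam_blocks) elem_cplus_in_units:
  assumes "i + 1 < h"
  shows "elem_cplus h lam l i \<in> carrier (lam_units h lam l)"
proof -
  have I: "(i, l i - 1) \<in> I" "(i + 1, 0) \<in> I"
    using assms l_pos[of i] l_pos[of "i + 1"] by (auto simp: blk_idx_def)
  \<comment> \<open>Positivity of \<open>lam i\<close> makes the exponent smaller than the column
    modulus, so the entry is already reduced.\<close>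
  have "lam (i + 1) - lam i < lam (i + 1)"
    using lam_pos[of i] lam_pos[of "i + 1"] assms by simp
  then have "red (elem_cplus h lam l i) = elem_cplus h lam l i"
    unfolding elem_cplus_transv[OF assms]
    by (intro red_transv I) (simp add: tpow_def mod_tpow_monom[unfolded tpow_def])
  moreover have "red (elem_cplus h lam l i) \<in> carrier (lam_units h lam l)"
    unfolding elem_cplus_transv[OF assms] by (intro transv_in_units I) simp_all
  ultimately show ?thesis by metis
qed

lemma (in lam_blocks) elem_cminus_in_units:
  assumes "i + 1 < h"
  shows "elem_cminus h l i \<in> carrier (lam_units h lam l)"
proof -
  have I: "(i, l i - 1) \<in> I" "(i + 1, 0) \<in> I"
    using assms l_pos[of i] l_pos[of "i + 1"] by (auto simp: blk_idx_def)
  have "red (elem_cminus h l i) = elem_cminus h l i"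
    unfolding elem_cminus_transv[OF assms]
    by (intro red_transv I) (use assms lam_pos in \<open>simp add: mod_tpow_one\<close>)
  moreover have "red (elem_cminus h l i) \<in> carrier (lam_units h lam l)"
    unfolding elem_cminus_transv[OF assms]
    using lam_Suc[OF assms] by (intro transv_in_units I) simp_all
  ultimately show ?thesis by metis
qed

theorem theorem2p2p4:
  fixes p a h :: nat
    and \<omega> :: "'a::{finite, field}"
    and lam l :: "nat \<Rightarrow> nat"
    and Y :: "nat \<Rightarrow> (nat \<Rightarrow> nat \<Rightarrow> 'a) set"
  assumes "prime p" and "card (UNIV :: 'a set) = p ^ a"
    and "\<omega> \<noteq> 0" and "\<forall>x::'a. x \<noteq> 0 \<longrightarrow> (\<exists>k::nat. x = \<omega> ^ k)"
    and "h \<ge> 1"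
    and "\<forall>i. i + 1 < h \<longrightarrow> lam i < lam (i + 1)"
    and "\<forall>i<h. 0 < lam i" and "\<forall>i<h. 0 < l i"
    and "\<forall>i<h. Y i \<subseteq> carrier (GL_grp (l i))
               \<and> generate (GL_grp (l i)) (Y i) = carrier (GL_grp (l i))"
  shows "generate (lam_units h lam l)
      ({elem_a h l i (const_mat y) | i y. i < h \<and> y \<in> Y i}
       \<union> {elem_b h l i (1 + monom (\<omega> ^ j) k) | i j k. i < h \<and> j \<le> a \<and> 1 \<le> k \<and> k \<le> lam i - 1}
       \<union> {elem_cplus h lam l i | i. i + 1 < h}
       \<union> {elem_cminus h l i | i. i + 1 < h})
    = carrier (lam_units h lam l)"
    (is "generate ?U ?S = _")
proof
  interpret lam_blocks h lam l
    by unfold_locales (use assms(6-8) in blast)+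
  interpret U: Group.group ?U
    by (rule group_lam_units)
  have S: "?S \<subseteq> carrier ?U"
    using assms(9) by (auto intro!: elem_a_in_units elem_b_in_units elem_cplus_in_units[simplified]
        elem_cminus_in_units[simplified])
  then show "generate ?U ?S \<subseteq> carrier ?U"
    by (rule U.generate_incl)
  \<comment> \<open>\<open>W\<close> becomes the set of powers up to exponent \<open>a\<close>,
    which span the field additively by the counting argument.\<close>
  have "lam_generation h lam l (generate ?U ?S) ((\<lambda>j. \<omega> ^ j) ` {..a})"
  proof (intro lam_generation.intro lam_generation_axioms.intro lam_blocks_axioms)
    show "subgroup (generate ?U ?S) ?U"
      by (rule U.generate_is_subgroup[OF S])
    show "T = UNIV" if "0 \<in> T" "\<And>x y. x \<in> T \<Longrightarrow> y \<in> T \<Longrightarrow> x + y \<in> T" "(\<lambda>j. \<omega> ^ j) ` {..a} \<subseteq> T" for T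
      using additive_generation_by_powers[OF assms(1,2,4) that(1,2)] that(3) by blast
    show "elem_a h l i (const_mat y) \<in> generate ?U ?S" if "i < h" "y \<in> carrier (GL_grp (l i))" for i y
    proof -
      have "Y i \<subseteq> carrier (GL_grp (l i))" "y \<in> generate (GL_grp (l i)) (Y i)"
        using assms(9) that by auto
      note mem = elem_a_in_generate[OF that(1) this]
      have "(\<lambda>y. elem_a h l i (const_mat y)) ` Y i \<subseteq> ?S"
        using that(1) by blast
      from subsetD[OF U.mono_generate[OF this] mem] show ?thesis .
    qed
    show "elem_b h l i (1 + monom c k) \<in> generate ?U ?S"
      if "i < h" "c \<in> (\<lambda>j. \<omega> ^ j) ` {..a}" "1 \<le> k" "k < lam i" for i c k
    proof -
      have "k \<le> lam i - 1" using that(4) by simp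
      then have "elem_b h l i (1 + monom c k) \<in> ?S"
        using that by blast
      then show ?thesis by (rule generate.incl)
    qed
    show "elem_cplus h lam l i \<in> generate ?U ?S" "elem_cminus h l i \<in> generate ?U ?S" if "i + 1 < h" for i
      using that by (intro generate.incl; blast)+
  qed
  then show "carrier ?U \<subseteq> generate ?U ?S"
    by (rule lam_generation.units_subset)
qed

end
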